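(* Let $(X_n,\mathsf d_n,\mathfrak m_n,\bar x_n)$, $n\in\mathbb N$, be pointed metric measure spaces converging to the pointed metric measure space $(X_\infty,\mathsf d_\infty,\mathfrak m_\infty,\bar x_\infty)$ in the pointed measured Gromov–Hausdorff (pmGH) sense. Then $[X_n,\mathsf d_n,\mathfrak m_n,\bar x_n]\to[X_\infty,\mathsf d_\infty,\mathfrak m_\infty,\bar x_\infty]$ in the pointed measured Gromov (pmG) sense.
   Context: A pointed metric measure (p.m.m.) space $(X,\mathsf d,\mathfrak m,\bar x)$ consists of a complete separable metric space $(X,\mathsf d)$, a nonzero nonnegative Borel measure $\mathfrak m$ finite on bounded sets, and a point $\bar x\in\operatorname{supp}(\mathfrak m)$. Two p.m.m. spaces are isomorphic if there is an isometric embedding $\iota:\operatorname{supp}(\mathfrak m_1)\to X_2$ with $\iota_\sharp\mathfrak m_1=\mathfrak m_2$ and $\iota(\bar x_1)=\bar x_2$; $[X,\mathsf d,\mathfrak m,\bar x]$ denotes the isomorphism class. Weak convergence of measures finite on bounded sets is convergence of integrals of bounded continuous functions with bounded support. $\bar{\mathbb N}=\mathbb N\cup\{\infty\}$. pmG convergence: $[X_n,\mathsf d_n,\mathfrak m_n,\bar x_n]\to[X_\infty,\mathsf d_\infty,\mathfrak m_\infty,\bar x_\infty]$ if there are a complete separable metric space $(X,\mathsf d)$ and isometric embeddings $\iota_n:X_n\to X$, $n\in\bar{\mathbb N}$, such that $(\iota_n)_\sharp\mathfrak m_n\to(\iota_\infty)_\sharp\mathfrak m_\infty$ weakly and $\iota_n(\bar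 x_n)\to\iota_\infty(\bar x_\infty)$ in $X$. (This does not depend on the chosen representatives.) pmGH convergence: for every $\varepsilon,R>0$ there is $N(\varepsilon,R)\in\mathbb N$ such that for all $n\ge N(\varepsilon,R)$ there is a Borel map $f_n^{R,\varepsilon}:B_R(\bar x_n)\to X_\infty$ such that: - $f_n^{R,\varepsilon}(\bar x_n)=\bar x_\infty$; - $\sup_{x,y\in B_R(\bar x_n)}|\mathsf d_n(x,y)-\mathsf d_\infty(f_n^{R,\varepsilon}(x),f_n^{R,\varepsilon}(y))|\le\varepsilon$; - the $\varepsilon$-neighbourhood of $f_n^{R,\varepsilon}(B_R(\bar x_n))$ contains $B_{R-\varepsilon}(\bar x_\infty)$; - $(f_n^{R,\varepsilon})_\sharp(\mathfrak m_n|_{B_R(\bar x_n)})$ weakly converges to $\mathfrak m_\infty|_{B_R(\bar x_\infty)}$ as $n\to\infty$, for a.e. $R>0$. *)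

theory Defs
  imports "HOL-Analysis.Analysis"
begin

section \<open>Pointed metric measure spaces\<close>

definition borel_metric :: "'a metric \<Rightarrow> 'a measure" where
  "borel_metric X = sigma (mspace X) {U. openin (mtopology_of X) U}"

abbreviation mbounded_of :: "'a metric \<Rightarrow> 'a set \<Rightarrow> bool" where
  "mbounded_of X \<equiv> Metric_space.mbounded (mspace X) (mdist X)"

definition measure_supp :: "'a metric \<Rightarrow> 'a measure \<Rightarrow> 'a set" where
  "measure_supp X \<mu> =
     {x \<in> mspace X. \<forall>U. openin (mtopology_of X) U \<and> x \<in> U \<longrightarrow> emeasure \<mu> U > 0}"

record 'a pmm =
  pmm_metric :: "'a metric"
  pmm_measure :: "'a measure"
  pmm_point :: 'a

definition pmm_space :: "'a pmm \<Rightarrow> bool" where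
  "pmm_space X \<longleftrightarrow>
     mcomplete_of (pmm_metric X) \<and>
     separable_space (mtopology_of (pmm_metric X)) \<and>
     sets (pmm_measure X) = sets (borel_metric (pmm_metric X)) \<and>
     emeasure (pmm_measure X) (mspace (pmm_metric X)) \<noteq> 0 \<and>
     (\<forall>B \<in> sets (pmm_measure X). mbounded_of (pmm_metric X) B
        \<longrightarrow> emeasure (pmm_measure X) B < \<infinity>) \<and>
     pmm_point X \<in> measure_supp (pmm_metric X) (pmm_measure X)"

abbreviation pmm_ball :: "'a pmm \<Rightarrow> real \<Rightarrow> 'a set" where
  "pmm_ball X R \<equiv> mball_of (pmm_metric X) (pmm_point X) R"

section \<open>Weak convergence of measures finite on bounded sets\<close>

definition bounded_support_test :: "'a metric \<Rightarrow> ('a \<Rightarrow> real) \<Rightarrow> bool" where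
  "bounded_support_test X \<phi> \<longleftrightarrow>
     continuous_map (mtopology_of X) euclideanreal \<phi> \<and>
     bounded (\<phi> ` mspace X) \<and>
     mbounded_of X (mtopology_of X closure_of {x \<in> mspace X. \<phi> x \<noteq> 0})"

definition weakly_converges ::
    "'a metric \<Rightarrow> (nat \<Rightarrow> 'a measure) \<Rightarrow> 'a measure \<Rightarrow> bool" where
  "weakly_converges X \<mu> \<nu> \<longleftrightarrow>
     (\<forall>\<phi>. bounded_support_test X \<phi> \<longrightarrow>
        (\<lambda>n. integral\<^sup>L (\<mu> n) \<phi>) \<longlonglongrightarrow> integral\<^sup>L \<nu> \<phi>)"

section \<open>Pointed measured Gromov convergence\<close>

definition isometric_embedding :: "'a metric \<Rightarrow> 'b metric \<Rightarrow> ('a \<Rightarrow> 'b) \<Rightarrow> bool" where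
  "isometric_embedding X Y \<iota> \<longleftrightarrow>
     \<iota> \<in> mspace X \<rightarrow> mspace Y \<and>
     (\<forall>x \<in> mspace X. \<forall>y \<in> mspace X. mdist Y (\<iota> x) (\<iota> y) = mdist X x y)"

definition pmG_realization ::
    "(nat \<Rightarrow> 'a pmm) \<Rightarrow> 'b pmm \<Rightarrow> 'c metric \<Rightarrow> (nat \<Rightarrow> 'a \<Rightarrow> 'c) \<Rightarrow> ('b \<Rightarrow> 'c) \<Rightarrow> bool" where
  "pmG_realization X Xinf Z \<iota> \<iota>inf \<longleftrightarrow>
     mcomplete_of Z \<and> separable_space (mtopology_of Z) \<and>
     (\<forall>n. isometric_embedding (pmm_metric (X n)) Z (\<iota> n)) \<and>
     isometric_embedding (pmm_metric Xinf) Z \<iota>inf \<and>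
     weakly_converges Z
       (\<lambda>n. distr (pmm_measure (X n)) (borel_metric Z) (\<iota> n))
       (distr (pmm_measure Xinf) (borel_metric Z) \<iota>inf) \<and>
     limitin (mtopology_of Z) (\<lambda>n. \<iota> n (pmm_point (X n))) (\<iota>inf (pmm_point Xinf)) sequentially"

text \<open>
  HOL cannot quantify existentially over the type of the ambient space. This loses nothing:
  every complete separable metric space is isometric to one whose points are of type
  \<^typ>\<open>nat \<Rightarrow> real\<close> (lemma \<open>isometric_copy_nat_real\<close> below), with an arbitrary metric on an
  arbitrary subset of that type.

  The convergence is a property of isomorphism classes; it is stated through the given
  representatives, on which it does not depend.
\<close>

definition pmG_converges :: "(nat \<Rightarrow> 'a pmm) \<Rightarrow> 'b pmm \<Rightarrow> bool" where
  "pmG_converges X Xinf \<longleftrightarrow>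
     (\<exists>(Z :: (nat \<Rightarrow> real) metric) \<iota> \<iota>inf. pmG_realization X Xinf Z \<iota> \<iota>inf)"

lemma isometric_copy_nat_real:
  fixes X :: "'a metric"
  assumes complete: "mcomplete_of X" and sep: "separable_space (mtopology_of X)"
  obtains Y :: "(nat \<Rightarrow> real) metric" and \<iota>
  where "mcomplete_of Y" "separable_space (mtopology_of Y)"
    "isometric_embedding X Y \<iota>" "\<iota> ` mspace X = mspace Y"
proof -
  let ?d = "mdist X" and ?M = "mspace X"
  obtain C where C: "countable C" "C \<subseteq> ?M" "mtopology_of X closure_of C = ?M"
    using sep unfolding separable_space_def by auto
  define s where "s = from_nat_into C"
  define \<iota> where "\<iota> = (\<lambda>x n. ?d x (s n))"
  interpret X: Metric_space ?M ?d by simp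
  have inj: "inj_on \<iota> ?M"
  proof (rule inj_onI, rule ccontr)
    fix x y assume xy: "x \<in> ?M" "y \<in> ?M" "\<iota> x = \<iota> y" "x \<noteq> y"
    have pos: "?d x y > 0" using xy by auto
    have "x \<in> X.mtopology closure_of C" using C xy unfolding mtopology_of_def by simp
    then obtain c where c: "c \<in> C" "c \<in> X.mball x (?d x y / 2)"
      using pos unfolding X.metric_closure_of by (auto dest!: spec[of _ "?d x y / 2"])
    obtain n where n: "s n = c"
      using from_nat_into_surj[OF C(1) c(1)] unfolding s_def by auto
    have "?d x c = ?d y c" using fun_cong[OF xy(3), of n] n unfolding \<iota>_def by simp
    moreover have "?d x c < ?d x y / 2" using c by simp
    moreover have "?d x y \<le> ?d x c + ?d c y"
      using xy C(2) c(1) by (intro mdist_triangle) auto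
    ultimately show False by (simp add: mdist_commute)
  qed
  define g where "g = inv_into ?M \<iota>"
  have g: "\<And>x. x \<in> ?M \<Longrightarrow> g (\<iota> x) = x" unfolding g_def using inj by simp
  define d' where "d' = (\<lambda>u v. ?d (g u) (g v))"
  have M: "Metric_space (\<iota> ` ?M) d'"
    by unfold_locales (auto simp: d'_def g mdist_commute intro: mdist_triangle)
  interpret Y: Metric_space "\<iota> ` ?M" d' by (rule M)
  interpret XY: Metric_space12 ?M ?d "\<iota> ` ?M" d' ..
  have hom: "homeomorphic_map X.mtopology Y.mtopology \<iota>"
    by (rule XY.isometry_imp_homeomorphic_map) (auto simp: d'_def g)
  have compl: "Y.mcomplete"
    unfolding Y.mcomplete_def
  proof (intro allI impI)
    fix \<sigma> assume \<sigma>: "Y.MCauchy \<sigma>"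
    have \<sigma>M: "\<sigma> n \<in> \<iota> ` ?M" for n using \<sigma> unfolding Y.MCauchy_def by auto
    have gM: "g (\<sigma> n) \<in> ?M" "\<iota> (g (\<sigma> n)) = \<sigma> n" for n using \<sigma>M[of n] g by auto
    have "X.MCauchy (g \<circ> \<sigma>)"
      using \<sigma>[unfolded Y.MCauchy_def, unfolded d'_def] gM(1) unfolding X.MCauchy_def by auto
    then obtain x where x: "limitin X.mtopology (g \<circ> \<sigma>) x sequentially"
      using complete unfolding mcomplete_of_def X.mcomplete_def by blast
    have "limitin Y.mtopology (\<iota> \<circ> (g \<circ> \<sigma>)) (\<iota> x) sequentially"
      using hom x by (intro continuous_map_limit) (auto dest: homeomorphic_imp_continuous_map)
    moreover have "\<iota> \<circ> (g \<circ> \<sigma>) = \<sigma>" using gM by auto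
    ultimately show "\<exists>y. limitin Y.mtopology \<sigma> y sequentially" by auto
  qed
  have sepY: "separable_space Y.mtopology"
    using sep homeomorphic_separable_space[OF homeomorphic_map_imp_homeomorphic_space[OF hom]]
    unfolding mtopology_of_def by simp
  show thesis
    by (rule that[of "metric (\<iota> ` ?M, d')" \<iota>])
      (auto simp: compl sepY isometric_embedding_def d'_def[symmetric] g, auto simp: d'_def g)
qed

section \<open>Pointed measured Gromov--Hausdorff convergence\<close>

definition approximates :: "real \<Rightarrow> real \<Rightarrow> 'a pmm \<Rightarrow> 'b pmm \<Rightarrow> ('a \<Rightarrow> 'b) \<Rightarrow> bool" where
  "approximates R \<epsilon> X Y f \<longleftrightarrow>
     f \<in> measurable (restrict_space (borel_metric (pmm_metric X)) (pmm_ball X R))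
           (borel_metric (pmm_metric Y)) \<and>
     f (pmm_point X) = pmm_point Y \<and>
     (\<forall>x \<in> pmm_ball X R. \<forall>y \<in> pmm_ball X R.
        \<bar>mdist (pmm_metric X) x y - mdist (pmm_metric Y) (f x) (f y)\<bar> \<le> \<epsilon>) \<and>
     pmm_ball Y (R - \<epsilon>) \<subseteq> (\<Union>x \<in> pmm_ball X R. mball_of (pmm_metric Y) (f x) \<epsilon>)"

text \<open>
  In \<open>approximates\<close>, balls are open, and the last clause takes the open \<open>\<epsilon>\<close>-neighbourhood.

  \<open>N R \<epsilon>\<close> and \<open>f R \<epsilon> n\<close> are chosen before the last clause because it speaks of almost every
  radius. The exceptional null set of radii may depend on \<open>\<epsilon>\<close>. The restriction of the limit
  measure to a ball is a measure on the whole limit space, hence a density and not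
  \<^const>\<open>restrict_space\<close>, which would shrink the underlying space.
\<close>

definition pmGH_converges :: "(nat \<Rightarrow> 'a pmm) \<Rightarrow> 'b pmm \<Rightarrow> bool" where
  "pmGH_converges X Xinf \<longleftrightarrow>
     (\<exists>(N :: real \<Rightarrow> real \<Rightarrow> nat) (f :: real \<Rightarrow> real \<Rightarrow> nat \<Rightarrow> 'a \<Rightarrow> 'b).
        (\<forall>\<epsilon>>0. \<forall>R>0. \<forall>n \<ge> N R \<epsilon>. approximates R \<epsilon> (X n) Xinf (f R \<epsilon> n)) \<and>
        (\<forall>\<epsilon>>0. AE R in lborel. R > 0 \<longrightarrow>
           weakly_converges (pmm_metric Xinf)
             (\<lambda>n. distr (restrict_space (pmm_measure (X n)) (pmm_ball (X n) R))
                    (borel_metric (pmm_metric Xinf)) (f R \<epsilon> n))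
             (density (pmm_measure Xinf) (indicator (pmm_ball Xinf R)))))"

end

theory Submission
  imports Defs
begin

text \<open>
  A diagonal choice of scales \<open>r n \<rightarrow> \<infinity>\<close> and errors \<open>e n \<rightarrow> 0\<close> gives one approximation
  \<open>F n\<close> per index, such that the push-forwards of the restricted measures still converge weakly;
  this is possible because weak convergence need only be tested on countably many Lipschitz
  functions, the finite maxima of truncated cones centred at a dense sequence. All spaces are then
  glued to the limit space, with \<open>x\<close> and \<open>F n x\<close> at distance at most \<open>e n\<close>, and the glued space is
  completed. A Lipschitz test function of bounded support changes by \<open>O(e n)\<close> when \<open>x\<close> is replaced
  by \<open>F n x\<close>, and the masses of balls are bounded, so the integrals have the same limit.
\<close>

text \<open>pmG convergence asks for one embedding per index, while pmGH convergence supplies a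
  separate sequence of maps for each pair (R, \<epsilon>), with a weak limit only for the pair
  fixed. A diagonal sequence can meet only finitely many conditions at each scale, hence the
  countable test family fixed in advance. Cones are suitable because they are built from distances
  alone: a cone centred at the image of a point of the limit space pulls back to the cone at that
  point, so no test function has to be extended from the limit space to the ambient one. The centres
  are dense only in the image of the limit space; this suffices because the limit measure is carried
  by that image, where a nonnegative continuous function is the supremum of the spikes below it.
  Such suprema give lower bounds for integrals only, and two-sided bounds come from a dominating
  spike plus and minus the test function. In the gluing, the positive price of every crossing keeps
  distinct points apart, so no quotient is formed.\<close>

section \<open>Separability and completion of metric spaces\<close>

lemma mdist_self [simp]: "x \<in> mspace m \<Longrightarrow> mdist m x x = 0"
  by simp

lemma closure_of_mtopology_of:
  "z \<in> mtopology_of Z closure_of S \<longleftrightarrow>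
     z \<in> mspace Z \<and> (\<forall>r>0. \<exists>y\<in>S. y \<in> mspace Z \<and> mdist Z z y < r)"
  unfolding mtopology_of_def
  by (subst Metric_space.metric_closure_of[OF Metric_space_mspace_mdist])
    (auto simp: Metric_space.in_mball[OF Metric_space_mspace_mdist])

lemma separable_space_mtopology_of:
  "separable_space (mtopology_of Z) \<longleftrightarrow>
     (\<exists>C. countable C \<and> C \<subseteq> mspace Z \<and> (\<forall>z\<in>mspace Z. \<forall>r>0. \<exists>y\<in>C. mdist Z z y < r))"
proof -
  have "mtopology_of Z closure_of C = mspace Z \<longleftrightarrow> (\<forall>z\<in>mspace Z. \<forall>r>0. \<exists>y\<in>C. mdist Z z y < r)"
    if "C \<subseteq> mspace Z" for C
    using that closure_of_mtopology_of[of _ Z C] by (auto simp: set_eq_iff subset_iff) blast+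
  then show ?thesis unfolding separable_space_def by auto
qed

lemma isometric_embedding_comp:
  assumes "isometric_embedding X Y \<iota>" "isometric_embedding Y Z \<kappa>"
  shows "isometric_embedding X Z (\<kappa> \<circ> \<iota>)"
  using assms unfolding isometric_embedding_def by (auto simp: Pi_iff)

text \<open>The completion used here has points of type \<open>'a \<Rightarrow> real\<close>;
  \<open>isometric_copy_nat_real\<close> brings it back to \<open>nat \<Rightarrow> real\<close>.
  For this, separability must survive completion: a countable dense set of \<open>W\<close> has an
  image that is dense in the dense image of \<open>W\<close>.\<close>

lemma separable_metric_embeds_nat_real:
  fixes W :: "'a metric"
  assumes "separable_space (mtopology_of W)"
  obtains Z :: "(nat \<Rightarrow> real) metric" and \<iota>
  where "mcomplete_of Z" "separable_space (mtopology_of Z)" "isometric_embedding W Z \<iota>"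
proof -
  obtain f :: "'a \<Rightarrow> 'a \<Rightarrow> real" and V where V: "mcomplete_of V" "f \<in> mspace W \<rightarrow> mspace V"
    "mtopology_of V closure_of f ` mspace W = mspace V"
    "\<And>x y. \<lbrakk>x \<in> mspace W; y \<in> mspace W\<rbrakk> \<Longrightarrow> mdist V (f x) (f y) = mdist W x y"
    using Metric_space.metric_completion[OF Metric_space_mspace_mdist[of W]] by metis
  obtain C where C: "countable C" "C \<subseteq> mspace W" 
    "\<And>z r. z\<in>mspace W \<Longrightarrow> 0 < r \<Longrightarrow> \<exists>y\<in>C. mdist W z y < r"
    using assms unfolding separable_space_mtopology_of by blast
  have "\<exists>y\<in>f ` C. mdist V z y < r" if z: "z \<in> mspace V" and r: "r > 0" for z r
  proof -
    have "z \<in> mtopology_of V closure_of f ` mspace W" using z V by simp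
    then have "\<exists>y\<in>f ` mspace W. y \<in> mspace V \<and> mdist V z y < r / 2"
      using half_gt_zero[OF r] unfolding closure_of_mtopology_of by blast
    then obtain x where x: "x \<in> mspace W" "mdist V z (f x) < r / 2" by auto
    obtain y where y: "y \<in> C" "mdist W x y < r / 2" using C(3)[OF x(1), of "r / 2"] r by auto
    have "f x \<in> mspace V" "f y \<in> mspace V" "mdist V (f x) (f y) < r / 2"
      using x y C(2) V(2,4) by (auto simp: Pi_iff subset_iff)
    then have "mdist V z (f y) < r"
      using mdist_triangle[OF z, of "f x" "f y"] x by simp
    then show ?thesis using y by auto
  qed
  then have "separable_space (mtopology_of V)"
    unfolding separable_space_mtopology_of using C V(2)
    by (intro exI[of _ "f ` C"]) auto
  then obtain Z :: "(nat \<Rightarrow> real) metric" and \<iota> where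
    Z: "mcomplete_of Z" "separable_space (mtopology_of Z)" "isometric_embedding V Z \<iota>"
    using isometric_copy_nat_real[OF V(1)] by metis
  have "isometric_embedding W V f"
    using V unfolding isometric_embedding_def by auto
  with Z show thesis using that isometric_embedding_comp by blast
qed

section \<open>Gluing metric spaces along approximate isometries\<close>

text \<open>\<open>Y\<close> is a hub and each \<open>X i\<close> a spoke, joined to the hub by
  bridges of length \<open>e i\<close> from \<open>x\<close> to \<open>F i x\<close>. The bridges
  start only in \<open>B i\<close> because an approximation is controlled only on a ball.\<close>

locale star_gluing =
  fixes X :: "'i \<Rightarrow> 'a metric" and Y :: "'b metric"
    and B :: "'i \<Rightarrow> 'a set" and F :: "'i \<Rightarrow> 'a \<Rightarrow> 'b" and e :: "'i \<Rightarrow> real"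
  assumes B_nonempty: "B i \<noteq> {}"
    and B_subset: "B i \<subseteq> mspace (X i)"
    and F_mem: "x \<in> B i \<Longrightarrow> F i x \<in> mspace Y"
    and distortion: "x \<in> B i \<Longrightarrow> y \<in> B i \<Longrightarrow> \<bar>mdist (X i) x y - mdist Y (F i x) (F i y)\<bar> \<le> e i"
    and e_pos: "e i > 0"
begin

definition carrier :: "('i \<times> 'a + 'b) set" where
  "carrier = {u. case u of Inl (i, x) \<Rightarrow> x \<in> mspace (X i) | Inr y \<Rightarrow> y \<in> mspace Y}"

text \<open>Length of the shortest route from \<open>u\<close> to the hub point \<open>w\<close>:
  walk inside the spoke to some \<open>z\<close> in \<open>B i\<close>, cross, walk on in
  \<open>Y\<close>. Hub points get the distance of \<open>Y\<close>, so that \<open>through\<close>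
  treats both kinds of points alike.\<close>

definition bridge :: "'i \<times> 'a + 'b \<Rightarrow> 'b \<Rightarrow> real" where
  "bridge u w = (case u of
     Inl (i, x) \<Rightarrow> (INF z\<in>B i. mdist (X i) x z + e i + mdist Y (F i z) w)
   | Inr y \<Rightarrow> mdist Y y w)"

definition through :: "'i \<times> 'a + 'b \<Rightarrow> 'i \<times> 'a + 'b \<Rightarrow> real" where
  "through u v = (INF w\<in>mspace Y. bridge u w + bridge v w)"

text \<open>Only pairs in a common spoke keep their own distance. For two hub points
  \<open>through\<close> already returns the distance of \<open>Y\<close>, as
  \<open>through_Inr\<close> shows.\<close>

definition glued :: "'i \<times> 'a + 'b \<Rightarrow> 'i \<times> 'a + 'b \<Rightarrow> real" where
  "glued u v = (case (u, v) of
     (Inl (i, x), Inl (j, y)) \<Rightarrow> if i = j then mdist (X i) x y else through u v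
   | _ \<Rightarrow> through u v)"

lemma carrier_simps [simp]:
  "Inl (i, x) \<in> carrier \<longleftrightarrow> x \<in> mspace (X i)" "Inr y \<in> carrier \<longleftrightarrow> y \<in> mspace Y"
  by (auto simp: carrier_def)

lemma bridge_le:
  "z \<in> B i \<Longrightarrow> bridge (Inl (i, x)) w \<le> mdist (X i) x z + e i + mdist Y (F i z) w"
  unfolding bridge_def using e_pos[of i]
  by (auto intro!: cINF_lower bdd_belowI2[where m = 0] add_nonneg_nonneg)

lemma bridge_greatest:
  "(\<And>z. z \<in> B i \<Longrightarrow> c \<le> mdist (X i) x z + e i + mdist Y (F i z) w) \<Longrightarrow> c \<le> bridge (Inl (i, x)) w"
  unfolding bridge_def by (auto intro!: cINF_greatest simp: B_nonempty)

lemma bridge_Inr [simp]: "bridge (Inr y) w = mdist Y y w"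
  by (simp add: bridge_def)

lemma bridge_Inl_ge: "e i \<le> bridge (Inl (i, x)) w"
  by (rule bridge_greatest) simp

lemma bridge_nonneg: "0 \<le> bridge u w"
proof (cases u)
  case (Inl p)
  then show ?thesis using bridge_Inl_ge[of "fst p" "snd p" w] e_pos[of "fst p"] by simp
qed simp

lemma bridge_step:
  assumes u: "u \<in> carrier" and "a \<in> mspace Y" "b \<in> mspace Y"
  shows "bridge u b \<le> bridge u a + mdist Y a b"
proof (cases u)
  case (Inl p)
  obtain i x where p: "p = (i, x)" by (cases p)
  have "bridge u b - mdist Y a b \<le> bridge (Inl (i, x)) a"
  proof (rule bridge_greatest)
    fix z assume z: "z \<in> B i"
    show "bridge u b - mdist Y a b \<le> mdist (X i) x z + e i + mdist Y (F i z) a"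
      using bridge_le[OF z, of x b] mdist_triangle[OF F_mem[OF z] assms(2,3)] Inl p by simp
  qed
  then show ?thesis using Inl p by simp
qed (use assms in \<open>auto intro: mdist_triangle\<close>)

text \<open>An excursion from the hub into a spoke is no shortcut: \<open>F i\<close> may stretch
  the distance of the two feet \<open>z\<close> and \<open>z'\<close> by at most \<open>e i\<close>,
  and the two crossings cost \<open>2 * e i\<close>.\<close>

lemma le_bridge_add:
  assumes u: "u \<in> carrier" and "a \<in> mspace Y" "b \<in> mspace Y"
  shows "mdist Y a b \<le> bridge u a + bridge u b"
proof (cases u)
  case (Inl p)
  obtain i x where p: "p = (i, x)" by (cases p)
  have x: "x \<in> mspace (X i)" using u Inl p by simp
  have *: "mdist Y a b \<le> (mdist (X i) x z + e i + mdist Y (F i z) a)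
      + (mdist (X i) x z' + e i + mdist Y (F i z') b)" if z: "z \<in> B i" and z': "z' \<in> B i" for z z'
  proof -
    have "mdist Y a b \<le> mdist Y a (F i z) + mdist Y (F i z) (F i z') + mdist Y (F i z') b"
      using mdist_triangle[of a Y "F i z" b] mdist_triangle[of "F i z" Y "F i z'" b]
        F_mem[OF z] F_mem[OF z'] assms by simp
    moreover have "mdist (X i) z z' \<le> mdist (X i) z x + mdist (X i) x z'"
      using B_subset z z' x by (intro mdist_triangle) auto
    ultimately show ?thesis
      using distortion[OF z z'] e_pos[of i] by (simp add: mdist_commute)
  qed
  have "mdist Y a b - (mdist (X i) x z + e i + mdist Y (F i z) a) \<le> bridge u b" if "z \<in> B i" for z
    unfolding Inl p by (rule bridge_greatest) (use *[OF that] in \<open>simp add: algebra_simps\<close>)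
  then have "mdist Y a b - bridge u b \<le> bridge (Inl (i, x)) a"
    by (intro bridge_greatest) (simp add: algebra_simps)
  then show ?thesis using Inl p by simp
next
  case (Inr y)
  then show ?thesis using u mdist_triangle[OF assms(2) _ assms(3), of y] by (simp add: mdist_commute)
qed

lemma bridge_move:
  assumes "x \<in> mspace (X i)" "y \<in> mspace (X i)"
  shows "bridge (Inl (i, x)) w \<le> mdist (X i) x y + bridge (Inl (i, y)) w"
proof -
  have "bridge (Inl (i, x)) w - mdist (X i) x y \<le> bridge (Inl (i, y)) w"
  proof (rule bridge_greatest)
    fix z assume z: "z \<in> B i"
    have "mdist (X i) x z \<le> mdist (X i) x y + mdist (X i) y z"
      using B_subset z assms by (intro mdist_triangle) auto
    then show "bridge (Inl (i, x)) w - mdist (X i) x y \<le> mdist (X i) y z + e i + mdist Y (F i z) w"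
      using bridge_le[OF z, of x w] by simp
  qed
  then show ?thesis by simp
qed

text \<open>The mirror image of \<open>le_bridge_add\<close>: a detour from a spoke through the hub
  saves at most the distortion \<open>e i\<close> and pays for two crossings.\<close>

lemma le_bridge_add_same:
  assumes "x \<in> mspace (X i)" "y \<in> mspace (X i)" "w \<in> mspace Y"
  shows "mdist (X i) x y \<le> bridge (Inl (i, x)) w + bridge (Inl (i, y)) w"
proof -
  have *: "mdist (X i) x y \<le> (mdist (X i) x z + e i + mdist Y (F i z) w)
      + (mdist (X i) y z' + e i + mdist Y (F i z') w)" if z: "z \<in> B i" and z': "z' \<in> B i" for z z'
  proof -
    have "mdist (X i) x y \<le> mdist (X i) x z + mdist (X i) z z' + mdist (X i) z' y"
      using mdist_triangle[of x "X i" z y] mdist_triangle[of z "X i" z' y] B_subset[of i] z z' assms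
      by (simp add: subset_iff)
    moreover have "mdist Y (F i z) (F i z') \<le> mdist Y (F i z) w + mdist Y w (F i z')"
      using F_mem z z' assms by (intro mdist_triangle) auto
    ultimately show ?thesis
      using distortion[OF z z'] e_pos[of i] by (simp add: mdist_commute)
  qed
  have "mdist (X i) x y - (mdist (X i) x z + e i + mdist Y (F i z) w) \<le> bridge (Inl (i, y)) w" if "z \<in> B i" for z
    by (rule bridge_greatest) (use *[OF that] in \<open>simp add: algebra_simps\<close>)
  then have "mdist (X i) x y - bridge (Inl (i, y)) w \<le> bridge (Inl (i, x)) w"
    by (intro bridge_greatest) (simp add: algebra_simps)
  then show ?thesis by simp
qed

lemma Y_nonempty: "mspace Y \<noteq> {}"
  using B_nonempty F_mem by blast

lemma through_le: "w \<in> mspace Y \<Longrightarrow> through u v \<le> bridge u w + bridge v w"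
  unfolding through_def
  by (auto intro!: cINF_lower bdd_belowI2[where m = 0] add_nonneg_nonneg bridge_nonneg)

lemma through_greatest:
  "(\<And>w. w \<in> mspace Y \<Longrightarrow> c \<le> bridge u w + bridge v w) \<Longrightarrow> c \<le> through u v"
  unfolding through_def by (rule cINF_greatest[OF Y_nonempty])

lemma through_commute: "through u v = through v u"
  by (simp add: through_def add.commute)

lemma through_Inr:
  assumes "u \<in> carrier" "y \<in> mspace Y"
  shows "through u (Inr y) = bridge u y"
proof (rule antisym)
  show "through u (Inr y) \<le> bridge u y" using through_le[OF assms(2), of u "Inr y"] assms by simp
  show "bridge u y \<le> through u (Inr y)"
    by (rule through_greatest) (use bridge_step assms in \<open>auto simp: mdist_commute\<close>)
qed

text \<open>Core of the triangle inequality. On a route from \<open>u\<close> to hub point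
  \<open>a\<close>, to \<open>v\<close>, to hub point \<open>b\<close>, to \<open>u'\<close>, the
  excursion to \<open>v\<close> can be replaced by the segment from \<open>a\<close> to
  \<open>b\<close>, which is then absorbed into \<open>bridge u b\<close>. What remains passes one
  hub point. The bound \<open>c\<close> is left abstract to cover both \<open>through\<close> and
  the distance within a spoke.\<close>

lemma le_through_add:
  assumes "v \<in> carrier" "u \<in> carrier"
    and "\<And>w. w \<in> mspace Y \<Longrightarrow> c \<le> bridge u w + bridge u' w"
  shows "c \<le> through u v + through v u'"
proof -
  have "c \<le> (bridge u a + bridge v a) + (bridge v b + bridge u' b)"
    if "a \<in> mspace Y" "b \<in> mspace Y" for a b
    using le_bridge_add[OF assms(1) that] bridge_step[OF assms(2) that] assms(3)[OF that(2)] by linarith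
  then have "c - (bridge u a + bridge v a) \<le> through v u'" if "a \<in> mspace Y" for a
    using that by (intro through_greatest) (smt (verit))
  then have "c - through v u' \<le> through u v"
    by (intro through_greatest) (simp add: algebra_simps)
  then show ?thesis by simp
qed

lemma through_move:
  assumes "x \<in> mspace (X i)" "y \<in> mspace (X i)"
  shows "through (Inl (i, x)) v \<le> mdist (X i) x y + through (Inl (i, y)) v"
proof -
  have "through (Inl (i, x)) v - mdist (X i) x y \<le> through (Inl (i, y)) v"
  proof (rule through_greatest)
    fix w assume w: "w \<in> mspace Y"
    show "through (Inl (i, x)) v - mdist (X i) x y \<le> bridge (Inl (i, y)) w + bridge v w"
      using through_le[OF w, of "Inl (i, x)" v] bridge_move[OF assms, of w] by linarith
  qed
  then show ?thesis by simp
qed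

lemma through_nonneg: "0 \<le> through u v"
  by (rule through_greatest) (simp add: bridge_nonneg)

lemma through_Inl_pos: "0 < through (Inl (i, x)) v"
proof -
  have "e i \<le> through (Inl (i, x)) v"
    by (rule through_greatest) (use bridge_Inl_ge[of i x] bridge_nonneg[of v] in \<open>simp add: add_increasing2\<close>)
  then show ?thesis using e_pos[of i] by simp
qed

lemma glued_eq:
  "glued (Inl (i, x)) (Inl (j, y)) = (if i = j then mdist (X i) x y else through (Inl (i, x)) (Inl (j, y)))"
  "glued (Inr w) v = through (Inr w) v" "glued v (Inr w) = through v (Inr w)"
  by (auto simp: glued_def split: sum.split prod.split)

lemma Metric_space_glued: "Metric_space carrier glued"
proof
  show "0 \<le> glued u v" for u v
    by (auto simp: glued_def through_nonneg split: sum.split prod.split)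
  show "glued u v = glued v u" for u v
    by (auto simp: glued_def through_commute mdist_commute split: sum.split prod.split)
  show "glued u v = 0 \<longleftrightarrow> u = v" if "u \<in> carrier" "v \<in> carrier" for u v
  proof -
    have "through (Inl (i, x)) w \<noteq> 0" "through w (Inl (i, x)) \<noteq> 0" for i x w
      using through_Inl_pos[of i x w] by (auto simp: through_commute[of w])
    then show ?thesis using that
      by (cases u; cases v) (auto simp: glued_eq through_Inr[of "Inr _"] split: if_splits)
  qed
  show "glued u w \<le> glued u v + glued v w"
    if uvw: "u \<in> carrier" "v \<in> carrier" "w \<in> carrier" for u v w
  proof -
    \<comment> \<open>The cases of the triangle inequality not internal to one spoke:
      \<open>same\<close> has both ends in one spoke and a detour outside, \<open>diff\<close> has
      only legs through the hub, and \<open>left\<close> and \<open>right\<close> have one leg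
      inside a spoke.\<close>
    have same: "mdist (X i) x y \<le> through (Inl (i, x)) v + through v (Inl (i, y))"
      if "x \<in> mspace (X i)" "y \<in> mspace (X i)" for i x y
      using that uvw by (intro le_through_add le_bridge_add_same) auto
    have diff: "through u w \<le> through u v + through v w"
      using uvw by (intro le_through_add through_le)
    have left: "through (Inl (i, x)) w \<le> mdist (X i) x y + through (Inl (i, y)) w"
      if "x \<in> mspace (X i)" "y \<in> mspace (X i)" for i x y
      using through_move that .
    have right: "through u (Inl (i, y)) \<le> through u (Inl (i, x)) + mdist (X i) x y"
      if "x \<in> mspace (X i)" "y \<in> mspace (X i)" for i x y
      using through_move[OF that(2,1), of u] by (simp add: through_commute mdist_commute)
    show ?thesis
      using uvw same diff left right 
      by (cases u; cases v; cases w)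
        (auto simp: glued_eq intro!: mdist_triangle split: if_splits)
  qed
qed

lemma separable_glued:
  assumes "countable (UNIV :: 'i set)"
    and sepX: "\<And>i. separable_space (mtopology_of (X i))" and sepY: "separable_space (mtopology_of Y)"
  shows "separable_space (mtopology_of (metric (carrier, glued)))"
proof -
  interpret G: Metric_space carrier glued by (rule Metric_space_glued)
  obtain C where C: "\<And>i. countable (C i)" "\<And>i. C i \<subseteq> mspace (X i)"
    "\<And>i z r. z \<in> mspace (X i) \<Longrightarrow> 0 < r \<Longrightarrow> \<exists>y\<in>C i. mdist (X i) z y < r"
    using sepX unfolding separable_space_mtopology_of by metis
  obtain C' where C': "countable C'" "C' \<subseteq> mspace Y"
    "\<And>z r. z \<in> mspace Y \<Longrightarrow> 0 < r \<Longrightarrow> \<exists>y\<in>C'. mdist Y z y < r"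
    using sepY unfolding separable_space_mtopology_of by metis
  let ?C = "(\<Union>i. (\<lambda>x. Inl (i, x)) ` C i) \<union> Inr ` C'"
  have "\<exists>y\<in>?C. glued u y < r" if u: "u \<in> carrier" "r > 0" for u r
  proof (cases u)
    case (Inl p)
    obtain i x where p: "p = (i, x)" by (cases p)
    then show ?thesis using C(3)[of x i r] Inl that
      by (auto simp: glued_eq intro!: bexI[of _ "Inl (i, _)"])
  next
    case (Inr y)
    then obtain y' where "y' \<in> C'" "mdist Y y y' < r" using C'(3)[of y r] u Inr by auto
    then show ?thesis using Inr that C'(2) by (auto simp: glued_eq through_Inr intro!: bexI[of _ "Inr y'"])
  qed
  moreover have "countable ?C" using C(1) C'(1) assms(1) by auto
  moreover have "?C \<subseteq> carrier" using subsetD[OF C(2)] C'(2) by auto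
  ultimately show ?thesis
    unfolding separable_space_mtopology_of by (intro exI[of _ ?C]) simp
qed

lemma glued_B_le: "x \<in> B i \<Longrightarrow> glued (Inl (i, x)) (Inr (F i x)) \<le> e i"
  using bridge_le[of x i x "F i x"] B_subset[of i] F_mem[of x i]
  by (auto simp: glued_eq through_Inr subset_iff)

text \<open>Hides the sum type and the formula for the metric: the later argument uses only the
  embeddings and the bound on the distance between \<open>x\<close> and
  \<open>F i x\<close>.\<close>

lemma gluing_embeds_nat_real:
  assumes "countable (UNIV :: 'i set)"
    and "\<And>i. separable_space (mtopology_of (X i))" and "separable_space (mtopology_of Y)"
  obtains Z :: "(nat \<Rightarrow> real) metric" and \<iota> \<iota>inf
  where "mcomplete_of Z" "separable_space (mtopology_of Z)"
    "\<And>i. isometric_embedding (X i) Z (\<iota> i)" "isometric_embedding Y Z \<iota>inf"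
    "\<And>i x. x \<in> B i \<Longrightarrow> mdist Z (\<iota> i x) (\<iota>inf (F i x)) \<le> e i"
proof -
  interpret G: Metric_space carrier glued by (rule Metric_space_glued)
  obtain Z :: "(nat \<Rightarrow> real) metric" and \<kappa> where Z: "mcomplete_of Z" "separable_space (mtopology_of Z)"
    "isometric_embedding (metric (carrier, glued)) Z \<kappa>"
    using separable_metric_embeds_nat_real[OF separable_glued[OF assms]] by metis
  show thesis
  proof (rule that[of Z "\<lambda>i x. \<kappa> (Inl (i, x))" "\<lambda>y. \<kappa> (Inr y)"])
    show "mdist Z (\<kappa> (Inl (i, x))) (\<kappa> (Inr (F i x))) \<le> e i" if "x \<in> B i" for i x
      using Z(3) glued_B_le[OF that] B_subset[of i] F_mem[OF that] that
      by (auto simp: isometric_embedding_def subset_iff)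
  qed (use Z in \<open>auto simp: isometric_embedding_def Pi_iff glued_eq through_Inr\<close>)
qed

end

section \<open>Weak convergence tested on countably many Lipschitz functions\<close>

lemma space_borel_metric [simp]: "space (borel_metric Z) = mspace Z"
  unfolding borel_metric_def by (simp add: space_measure_of_conv)

lemma openin_sets_borel_metric: "openin (mtopology_of Z) U \<Longrightarrow> U \<in> sets (borel_metric Z)"
  unfolding borel_metric_def
  by (subst sets_measure_of) (auto dest!: openin_subset intro: sigma_sets.Basic)

lemma mball_of_sets_borel_metric: "mball_of Z a r \<in> sets (borel_metric Z)"
  unfolding mball_of_def mtopology_of_def
  by (rule openin_sets_borel_metric[unfolded mtopology_of_def])
    (rule Metric_space.openin_mball[OF Metric_space_mspace_mdist])

lemma space_eq_mspace: "sets \<mu> = sets (borel_metric Z) \<Longrightarrow> space \<mu> = mspace Z"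
  by (metis sets_eq_imp_space_eq space_borel_metric)

lemma continuous_map_measurable_borel_metric:
  assumes "continuous_map (mtopology_of X) (mtopology_of Z) f"
  shows "f \<in> measurable (borel_metric X) (borel_metric Z)"
proof (subst borel_metric_def[of Z], rule measurable_measure_of)
  show "{U. openin (mtopology_of Z) U} \<subseteq> Pow (mspace Z)" by (auto dest!: openin_subset)
  show "f \<in> space (borel_metric X) \<rightarrow> mspace Z"
    using assms by (auto simp: continuous_map_def)
  show "f -` U \<inter> space (borel_metric X) \<in> sets (borel_metric X)"
    if "U \<in> {U. openin (mtopology_of Z) U}" for U
  proof -
    have "f -` U \<inter> space (borel_metric X) = {x \<in> topspace (mtopology_of X). f x \<in> U}" by auto
    then show ?thesis
      using assms that by (auto intro!: openin_sets_borel_metric simp: continuous_map_def)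
  qed
qed

lemma continuous_map_borel_measurable:
  fixes f :: "'a \<Rightarrow> real"
  assumes "continuous_map (mtopology_of X) euclideanreal f" "sets \<mu> = sets (borel_metric X)"
  shows "f \<in> borel_measurable \<mu>"
proof (rule borel_measurableI)
  fix U :: "real set" assume "open U"
  have "f -` U \<inter> space \<mu> = {x \<in> topspace (mtopology_of X). f x \<in> U}"
    using space_eq_mspace[OF assms(2)] by auto
  then show "f -` U \<inter> space \<mu> \<in> sets \<mu>"
    using assms \<open>open U\<close> by (auto intro!: openin_sets_borel_metric simp: continuous_map_def)
qed

lemma isometric_embedding_continuous_map:
  assumes "isometric_embedding X Z \<iota>"
  shows "continuous_map (mtopology_of X) (mtopology_of Z) \<iota>"
  using assms
  by (intro Lipschitz_continuous_imp_continuous_map)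
    (auto simp: Lipschitz_continuous_map_def isometric_embedding_def intro!: exI[of _ 1])

lemma isometric_embedding_measurable:
  assumes "isometric_embedding X Z \<iota>" "sets \<mu> = sets (borel_metric X)"
  shows "\<iota> \<in> measurable \<mu> (borel_metric Z)"
  using continuous_map_measurable_borel_metric[OF isometric_embedding_continuous_map[OF assms(1)]]
    measurable_cong_sets[OF assms(2) refl] by blast

section \<open>Truncated cones as test functions\<close>

text \<open>
  Rational heights and natural slopes make the index type countable; the slope is \<open>Suc j\<close> so that
  every \<open>spike\<close> has bounded support.
\<close>

fun spike :: "'a metric \<Rightarrow> (nat \<Rightarrow> 'a) \<Rightarrow> (rat \<times> nat \<times> nat) list \<Rightarrow> 'a \<Rightarrow> real" where
  "spike Z s [] x = 0"
| "spike Z s ((p, j, i) # l) x = max (of_rat p - real (Suc j) * mdist Z x (s i)) (spike Z s l x)"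

lemma spike_nonneg: "0 \<le> spike Z s l x"
  by (induction l) (auto simp: le_max_iff_disj)

lemma abs_spike [simp]: "\<bar>spike Z s l x\<bar> = spike Z s l x"
  by (simp add: spike_nonneg)

text \<open>Concatenation makes the family closed under finite maxima, so a countable supremum of
  spikes becomes the limit of one sequence of spikes.\<close>

lemma spike_append: "spike Z s (l @ l') x = max (spike Z s l x) (spike Z s l' x)"
  by (induction l) (auto simp: spike_nonneg max.assoc max_absorb2)

lemma spike_concat_le:
  "(\<And>l. l \<in> set ls \<Longrightarrow> spike Z s l x \<le> c) \<Longrightarrow> 0 \<le> c \<Longrightarrow> spike Z s (concat ls) x \<le> c"
  by (induction ls) (auto simp: spike_append)

lemma spike_le_concat: "l \<in> set ls \<Longrightarrow> spike Z s l x \<le> spike Z s (concat ls) x"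
  by (induction ls) (auto simp: spike_append le_max_iff_disj)

lemma spike_bounded: "\<exists>A\<ge>0. \<forall>x. spike Z s l x \<le> A"
proof (induction l)
  case (Cons a l)
  obtain p j i where a: "a = (p, j, i)" by (cases a) auto
  obtain A where A: "A \<ge> 0" "\<And>x. spike Z s l x \<le> A" using Cons by auto
  have "spike Z s (a # l) x \<le> max (of_rat p) A" for x
    using A(2)[of x] by (auto simp: a intro: max.coboundedI1 max.coboundedI2)
  then show ?case using A(1) by (intro exI[of _ "max (of_rat p) A"]) (auto simp: le_max_iff_disj)
qed auto

lemma spike_Lipschitz:
  assumes s: "\<And>i. s i \<in> mspace Z"
  shows "\<exists>L\<ge>0. \<forall>x\<in>mspace Z. \<forall>y\<in>mspace Z. \<bar>spike Z s l x - spike Z s l y\<bar> \<le> L * mdist Z x y"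
proof (induction l)
  case (Cons a l)
  obtain p j i where a: "a = (p, j, i)" by (cases a) auto
  obtain L where L: "L \<ge> 0"
    "\<And>x y. x \<in> mspace Z \<Longrightarrow> y \<in> mspace Z \<Longrightarrow> \<bar>spike Z s l x - spike Z s l y\<bar> \<le> L * mdist Z x y"
    using Cons by auto
  have "\<bar>spike Z s (a # l) x - spike Z s (a # l) y\<bar> \<le> (real (Suc j) + L) * mdist Z x y"
    if xy: "x \<in> mspace Z" "y \<in> mspace Z" for x y
  proof -
    have "\<bar>mdist Z x (s i) - mdist Z y (s i)\<bar> \<le> mdist Z x y"
      using mdist_triangle[OF xy s[of i]] mdist_triangle[OF xy(2,1) s[of i]]
      by (simp add: mdist_commute abs_le_iff)
    then have "real (Suc j) * \<bar>mdist Z x (s i) - mdist Z y (s i)\<bar> \<le> real (Suc j) * mdist Z x y"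
      by (intro mult_left_mono) auto
    then have 1: "\<bar>real (Suc j) * mdist Z x (s i) - real (Suc j) * mdist Z y (s i)\<bar> \<le> real (Suc j) * mdist Z x y"
      by (simp only: right_diff_distrib[symmetric] abs_mult abs_of_nat)
    have 2: "0 \<le> real (Suc j) * mdist Z x y" "0 \<le> L * mdist Z x y" using L(1) by auto
    show ?thesis unfolding a spike.simps distrib_right using 1 2 L(2)[OF xy] by linarith
  qed
  then show ?case using L(1) by (intro exI[of _ "real (Suc j) + L"]) auto
qed auto

lemma spike_continuous:
  assumes s: "\<And>i. s i \<in> mspace Z"
  shows "continuous_map (mtopology_of Z) euclideanreal (spike Z s l)"
proof -
  have "Lipschitz_continuous_map Z euclidean_metric (spike Z s l)"
    using spike_Lipschitz[of s Z l, OF s] by (auto simp: Lipschitz_continuous_map_def dist_real_def)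
  from Lipschitz_continuous_imp_continuous_map[OF this] show ?thesis by simp
qed

text \<open>A cone of height \<open>p\<close> and slope at least 1 vanishes beyond distance
  \<open>p\<close> from its centre. All supports are measured from the one point \<open>s 0\<close>,
  since mass is later assumed finite on balls around it.\<close>

lemma spike_support:
  assumes s: "\<And>i. s i \<in> mspace Z"
  shows "\<exists>r>0. \<forall>x\<in>mspace Z. spike Z s l x \<noteq> 0 \<longrightarrow> mdist Z (s 0) x < r"
proof (induction l)
  case (Cons a l)
  obtain p j i where a: "a = (p, j, i)" by (cases a) auto
  obtain r where r: "r > 0" "\<And>x. x \<in> mspace Z \<Longrightarrow> spike Z s l x \<noteq> 0 \<Longrightarrow> mdist Z (s 0) x < r"
    using Cons by auto
  have "mdist Z (s 0) x < max r (of_rat p + mdist Z (s 0) (s i))"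
    if x: "x \<in> mspace Z" "spike Z s (a # l) x \<noteq> 0" for x
  proof (cases "spike Z s l x = 0")
    case True
    then have "real (Suc j) * mdist Z x (s i) < of_rat p" using x(2) by (auto simp: a max_def split: if_splits)
    moreover have "1 * mdist Z x (s i) \<le> real (Suc j) * mdist Z x (s i)" by (intro mult_right_mono) auto
    ultimately have "mdist Z x (s i) < of_rat p" by simp
    then show ?thesis using mdist_triangle[OF s[of 0] s[of i] x(1)] by (simp add: mdist_commute)
  qed (use r(2)[OF x(1)] in auto)
  then show ?case using r(1) by (intro exI[of _ "max r (of_rat p + mdist Z (s 0) (s i))"]) auto
qed (auto intro: exI[of _ 1])

text \<open>This is what makes integrals of spikes over the limit space and over its image in the
  glued space literally equal.\<close>

lemma spike_isometric:
  assumes "isometric_embedding Y Z \<iota>" "\<And>i. s i \<in> mspace Y" "y \<in> mspace Y"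
  shows "spike Z (\<iota> \<circ> s) l (\<iota> y) = spike Y s l y"
  using assms by (induction l) (auto simp: isometric_embedding_def)

lemma bounded_support_test_spike:
  assumes s: "\<And>i. s i \<in> mspace Z"
  shows "bounded_support_test Z (spike Z s l)"
proof -
  interpret Metric_space "mspace Z" "mdist Z" by (rule Metric_space_mspace_mdist)
  obtain r where r: "\<And>x. x \<in> mspace Z \<Longrightarrow> spike Z s l x \<noteq> 0 \<Longrightarrow> mdist Z (s 0) x < r"
    using spike_support[of s Z l, OF s] by auto
  obtain A where "\<And>x. spike Z s l x \<le> A" using spike_bounded by blast
  then have "bounded (spike Z s l ` mspace Z)"
    unfolding bounded_iff using spike_nonneg by (intro exI[of _ A]) auto
  moreover have "mbounded {x \<in> mspace Z. spike Z s l x \<noteq> 0}"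
    by (rule mbounded_subset[OF mbounded_mball[of "s 0" r]]) (use r s in auto)
  ultimately show ?thesis
    using spike_continuous[of s Z l, OF s] 
    by (simp add: bounded_support_test_def mtopology_of_def mbounded_closure_of)
qed

lemma integrable_bounded_support:
  fixes f :: "'a \<Rightarrow> real"
  assumes "continuous_map (mtopology_of Z) euclideanreal f" and \<mu>: "sets \<mu> = sets (borel_metric Z)"
    and fin: "emeasure \<mu> (mball_of Z a r) < \<infinity>"
    and "\<And>x. x \<in> mspace Z \<Longrightarrow> \<bar>f x\<bar> \<le> A" "\<And>x. x \<in> mspace Z \<Longrightarrow> f x \<noteq> 0 \<Longrightarrow> x \<in> mball_of Z a r"
  shows "integrable \<mu> f"
proof (rule integrableI_bounded_set)
  show "f \<in> borel_measurable \<mu>" using continuous_map_borel_measurable assms(1,2) .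
  show "mball_of Z a r \<in> sets \<mu>" using mball_of_sets_borel_metric \<mu> by auto
qed (use assms space_eq_mspace[OF \<mu>] in \<open>auto intro!: AE_I2\<close>)

lemma integrable_spike:
  assumes s: "\<And>i. s i \<in> mspace Z" and \<mu>: "sets \<mu> = sets (borel_metric Z)"
    and fin: "\<And>r. emeasure \<mu> (mball_of Z (s 0) r) < \<infinity>"
  shows "integrable \<mu> (spike Z s l)"
proof -
  obtain r where r: "\<And>x. x \<in> mspace Z \<Longrightarrow> spike Z s l x \<noteq> 0 \<Longrightarrow> mdist Z (s 0) x < r"
    using spike_support[of s Z l, OF s] by auto
  obtain A where "\<And>x. spike Z s l x \<le> A" using spike_bounded by blast
  then show ?thesis
    using r s spike_nonneg
    by (intro integrable_bounded_support[OF spike_continuous \<mu> fin[of r], where A = A]) auto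
qed

text \<open>For nonnegative \<open>c\<close> one cone is enough: its height lies between
  \<open>c\<close> and \<open>\<psi> z\<close>, it is steep enough to be negative where
  \<open>\<psi>\<close> might drop below that height, and its centre is close enough to
  \<open>z\<close> to stay above \<open>c\<close> there.\<close>

lemma spike_below_continuous:
  assumes s: "\<And>i. s i \<in> mspace Z" and cont: "continuous_map (mtopology_of Z) euclideanreal \<psi>"
    and ge0: "\<And>x. x \<in> mspace Z \<Longrightarrow> 0 \<le> \<psi> x"
    and z: "z \<in> mspace Z" "\<And>r. r > 0 \<Longrightarrow> \<exists>i. mdist Z z (s i) < r" and c: "c < \<psi> z"
  shows "\<exists>l. (\<forall>x\<in>mspace Z. spike Z s l x \<le> \<psi> x) \<and> c < spike Z s l z"
proof (cases "c < 0")
  case True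
  then show ?thesis using ge0 by (intro exI[of _ "[]"]) auto
next
  case False
  interpret Metric_space "mspace Z" "mdist Z" by (rule Metric_space_mspace_mdist)
  obtain p where p: "c < of_rat p" "of_rat p < \<psi> z" using of_rat_dense[OF c] by blast
  have "openin (mtopology_of Z) {x \<in> topspace (mtopology_of Z). \<psi> x \<in> {of_rat p<..}}"
    using cont open_greaterThan unfolding continuous_map_def open_openin[symmetric] by blast
  then obtain \<delta> where \<delta>: "\<delta> > 0" "mball z \<delta> \<subseteq> {x \<in> mspace Z. of_rat p < \<psi> x}"
    using z p unfolding mtopology_of_def openin_mtopology by auto
  \<comment> \<open>With the centre within \<open>\<delta> / 2\<close> of \<open>z\<close>, points
    outside the ball of radius \<open>\<delta>\<close> are at least \<open>\<delta> / 2\<close> from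
    the centre; this slope makes the cone negative there.\<close>
  obtain j :: nat where j: "2 * of_rat p / \<delta> < real j" using reals_Archimedean2 by blast
  \<comment> \<open>The second bound keeps the loss of height at \<open>z\<close> itself below
    \<open>of_rat p - c\<close>.\<close>
  have pos: "0 < min (\<delta> / 2) ((of_rat p - c) / real (Suc j))" using \<delta> p by auto
  obtain i where i: "mdist Z z (s i) < min (\<delta> / 2) ((of_rat p - c) / real (Suc j))"
    using z(2)[OF pos] by blast
  show ?thesis
  proof (intro exI[of _ "[(p, j, i)]"] conjI ballI)
    fix x assume x: "x \<in> mspace Z"
    have "of_rat p - real (Suc j) * mdist Z x (s i) \<le> \<psi> x"
    proof (cases "mdist Z z x < \<delta>")
      case True
      then have "of_rat p < \<psi> x" using \<delta>(2) x z(1) by auto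
      then show ?thesis 
        using mult_nonneg_nonneg[OF of_nat_0_le_iff[of "Suc j"] mdist_nonneg[of Z x "s i"]] by linarith
    next
      case False
      then have "\<delta> / 2 \<le> mdist Z x (s i)"
        using mdist_triangle[OF z(1) s[of i] x] i by (simp add: mdist_commute)
      then have "real (Suc j) * (\<delta> / 2) \<le> real (Suc j) * mdist Z x (s i)" by (intro mult_left_mono) auto
      moreover have "2 * of_rat p < real (Suc j) * \<delta>"
        using j \<delta>(1) by (simp add: field_simps)
      ultimately show ?thesis using ge0[OF x] by linarith
    qed
    then show "spike Z s [(p, j, i)] x \<le> \<psi> x" using ge0[OF x] by simp
  next
    have "real (Suc j) * mdist Z z (s i) < of_rat p - c"
      using i by (simp add: pos_less_divide_eq mult.commute)
    then show "c < spike Z s [(p, j, i)] z" by (simp add: less_max_iff_disj)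
  qed
qed

text \<open>Lower half of a portmanteau argument: some spike below \<open>\<psi>\<close> nearly
  exhausts its integral under \<open>\<nu>\<close>, its integrals converge, and under each
  \<open>\<mu> n\<close> it stays below \<open>\<psi>\<close>. Accumulation of the centres is asked
  only \<open>\<nu>\<close>-almost everywhere because \<open>Z\<close> may be much larger than the
  set carrying \<open>\<nu>\<close>.\<close>

lemma integral_le_liminf_if_spikes:
  assumes s: "\<And>i. s i \<in> mspace Z"
    and \<mu>: "\<And>n. sets (\<mu> n) = sets (borel_metric Z)" "\<And>n r. emeasure (\<mu> n) (mball_of Z (s 0) r) < \<infinity>"
    and \<nu>: "sets \<nu> = sets (borel_metric Z)" "\<And>r. emeasure \<nu> (mball_of Z (s 0) r) < \<infinity>"
    and dense: "AE z in \<nu>. \<forall>r>0. \<exists>i. mdist Z z (s i) < r"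
    and conv: "\<And>l. (\<lambda>n. integral\<^sup>L (\<mu> n) (spike Z s l)) \<longlonglongrightarrow> integral\<^sup>L \<nu> (spike Z s l)"
    and cont: "continuous_map (mtopology_of Z) euclideanreal \<psi>"
    and ge0: "\<And>x. x \<in> mspace Z \<Longrightarrow> 0 \<le> \<psi> x"
    and int: "\<And>n. integrable (\<mu> n) \<psi>" "integrable \<nu> \<psi>"
    and e: "e > 0"
  shows "\<forall>\<^sub>F n in sequentially. integral\<^sup>L \<nu> \<psi> - e < integral\<^sup>L (\<mu> n) \<psi>"
proof -
  define T where "T l \<longleftrightarrow> (\<forall>x\<in>mspace Z. spike Z s l x \<le> \<psi> x)" for l
  \<comment> \<open>The maximum of those among the first \<open>m\<close> spikes, in the enumeration
    of all lists, that stay below \<open>\<psi>\<close>.\<close>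
  define L where "L m = concat (filter T (map from_nat [0..<m]))" for m
  have T_L: "T (L m)" for m
    using ge0 unfolding T_def L_def by (auto intro!: spike_concat_le)
  have lim: "(\<lambda>m. spike Z s (L m) z) \<longlonglongrightarrow> \<psi> z"
    if z: "z \<in> mspace Z" "\<forall>r>0. \<exists>i. mdist Z z (s i) < r" for z
  proof (rule order_tendstoI)
    fix c assume "c < \<psi> z"
    then obtain l where l: "T l" "c < spike Z s l z"
      using spike_below_continuous[of s Z \<psi> z c, OF s cont ge0] z unfolding T_def by blast
    have "c < spike Z s (L m) z" if "to_nat l < m" for m
    proof -
      have "l \<in> set (filter T (map from_nat [0..<m]))" using l(1) that by (auto intro!: image_eqI[of _ _ "to_nat l"])
      then have "spike Z s l z \<le> spike Z s (L m) z" unfolding L_def by (rule spike_le_concat)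
      then show ?thesis using l(2) by simp
    qed
    then show "\<forall>\<^sub>F m in sequentially. c < spike Z s (L m) z"
      unfolding eventually_at_top_dense by blast
  next
    fix c assume "\<psi> z < c"
    then show "\<forall>\<^sub>F m in sequentially. spike Z s (L m) z < c"
      using T_L z(1) unfolding T_def by (intro always_eventually allI) (meson le_less_trans)
  qed
  have "(\<lambda>m. integral\<^sup>L \<nu> (spike Z s (L m))) \<longlonglongrightarrow> integral\<^sup>L \<nu> \<psi>"
  proof (rule integral_dominated_convergence[where w = \<psi>])
    show "AE z in \<nu>. (\<lambda>m. spike Z s (L m) z) \<longlonglongrightarrow> \<psi> z"
      using dense AE_space by eventually_elim (use lim space_eq_mspace[OF \<nu>(1)] in auto)
    show "AE z in \<nu>. norm (spike Z s (L m) z) \<le> \<psi> z" for m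
      using T_L[of m] spike_nonneg space_eq_mspace[OF \<nu>(1)] unfolding T_def by (intro AE_I2) auto
  qed (use int integrable_spike[of s Z \<nu>, OF s \<nu>] in \<open>auto intro: borel_measurable_integrable\<close>)
  then have "\<forall>\<^sub>F m in sequentially. integral\<^sup>L \<nu> \<psi> - e < integral\<^sup>L \<nu> (spike Z s (L m))"
    using e by (intro order_tendstoD) auto
  then obtain m where "integral\<^sup>L \<nu> \<psi> - e < integral\<^sup>L \<nu> (spike Z s (L m))"
    by (auto simp: eventually_sequentially)
  then have "\<forall>\<^sub>F n in sequentially. integral\<^sup>L \<nu> \<psi> - e < integral\<^sup>L (\<mu> n) (spike Z s (L m))"
    using conv by (intro order_tendstoD)
  then show ?thesis
  proof eventually_elim
    case (elim n)
    have "integral\<^sup>L (\<mu> n) (spike Z s (L m)) \<le> integral\<^sup>L (\<mu> n) \<psi>"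
      using T_L[of m] int(1) integrable_spike[of s Z "\<mu> n", OF s \<mu>] space_eq_mspace[OF \<mu>(1)]
      unfolding T_def by (intro integral_mono) auto
    then show ?case using elim by simp
  qed
qed

text \<open>A spike dominating \<open>\<bar>\<phi>\<bar>\<close> makes spike plus
  \<open>\<phi>\<close> and spike minus \<open>\<phi>\<close> nonnegative. The lower bounds for
  both, with convergence for the spike itself, enclose the integrals of
  \<open>\<phi>\<close>.\<close>

lemma weakly_converges_if_spikes:
  assumes s: "\<And>i. s i \<in> mspace Z"
    and \<mu>: "\<And>n. sets (\<mu> n) = sets (borel_metric Z)" "\<And>n r. emeasure (\<mu> n) (mball_of Z (s 0) r) < \<infinity>"
    and \<nu>: "sets \<nu> = sets (borel_metric Z)" "\<And>r. emeasure \<nu> (mball_of Z (s 0) r) < \<infinity>"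
    and dense: "AE z in \<nu>. \<forall>r>0. \<exists>i. mdist Z z (s i) < r"
    and conv: "\<And>l. (\<lambda>n. integral\<^sup>L (\<mu> n) (spike Z s l)) \<longlonglongrightarrow> integral\<^sup>L \<nu> (spike Z s l)"
  shows "weakly_converges Z \<mu> \<nu>"
  unfolding weakly_converges_def
proof (intro allI impI)
  interpret Metric_space "mspace Z" "mdist Z" by (rule Metric_space_mspace_mdist)
  fix \<phi> assume \<phi>: "bounded_support_test Z \<phi>"
  then have cont: "continuous_map (mtopology_of Z) euclideanreal \<phi>" by (simp add: bounded_support_test_def)
  obtain A where A: "\<And>x. x \<in> mspace Z \<Longrightarrow> \<bar>\<phi> x\<bar> \<le> A"
    using \<phi> by (auto simp: bounded_support_test_def bounded_iff)
  have "mbounded {x \<in> mspace Z. \<phi> x \<noteq> 0}"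
    using \<phi> mbounded_closure_of_eq[of "{x \<in> mspace Z. \<phi> x \<noteq> 0}"]
    by (auto simp: bounded_support_test_def mtopology_of_def)
  \<comment> \<open>\<open>mbounded_alt\<close> bounds mutual distances; adding \<open>s 0\<close>
    turns this into a bound on distances from \<open>s 0\<close>.\<close>
  then have "mbounded (insert (s 0) {x \<in> mspace Z. \<phi> x \<noteq> 0})" using s by (simp add: mbounded_insert)
  then obtain r0 where r0: "\<And>x. x \<in> mspace Z \<Longrightarrow> \<phi> x \<noteq> 0 \<Longrightarrow> mdist Z (s 0) x \<le> r0"
    unfolding mbounded_alt by auto
  obtain r :: nat where r: "r0 < real r" using reals_Archimedean2 by blast
  obtain J :: nat where J: "A < real J" using reals_Archimedean2 by blast
  \<comment> \<open>A cone of height \<open>(J + 1) * (r + 1)\<close> and slope \<open>J + 1\<close>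
    about \<open>s 0\<close> is still at least \<open>J + 1\<close>, hence above \<open>A\<close>,
    at distance \<open>r\<close>.\<close>
  define l where "l = [(of_nat (Suc J * Suc r) :: rat, J, 0 :: nat)]"
  have dom: "\<bar>\<phi> x\<bar> \<le> spike Z s l x" if x: "x \<in> mspace Z" for x
  proof (cases "\<phi> x = 0")
    case False
    have "mdist Z x (s 0) < real r" using r0[OF x False] r by (simp add: mdist_commute)
    then have "real (Suc J) * mdist Z x (s 0) \<le> real (Suc J) * real r" by (intro mult_left_mono) auto
    moreover have "spike Z s l x \<ge> real (Suc J) * real (Suc r) - real (Suc J) * mdist Z x (s 0)"
      unfolding l_def spike.simps
      by (rule order_trans[OF _ max.cobounded1])
        (simp only: of_nat_mult of_rat_mult of_rat_of_nat_eq order_refl)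
    moreover have "real (Suc J) * real (Suc r) = real (Suc J) * real r + real (Suc J)" by (simp add: algebra_simps)
    moreover have "real J \<le> real (Suc J)" by simp
    ultimately show ?thesis using A[OF x] J by linarith
  qed (simp add: spike_nonneg)
  have supp: "x \<in> mball_of Z (s 0) (real r)" if "x \<in> mspace Z" "\<phi> x \<noteq> 0" for x
    using r0[OF that] r s that by auto
  have int_\<phi>: "integrable (\<mu> n) \<phi>" "integrable \<nu> \<phi>" for n
    using integrable_bounded_support[OF cont \<mu>(1) \<mu>(2) A supp]
      integrable_bounded_support[OF cont \<nu>(1) \<nu>(2) A supp] by auto
  have int_l: "integrable (\<mu> n) (spike Z s l)" "integrable \<nu> (spike Z s l)" for n
    using integrable_spike[of s Z, OF s] \<mu> \<nu> by auto
  have cont_l: "continuous_map (mtopology_of Z) euclideanreal (spike Z s l)"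
    using spike_continuous[of s Z, OF s] .
  show "(\<lambda>n. integral\<^sup>L (\<mu> n) \<phi>) \<longlonglongrightarrow> integral\<^sup>L \<nu> \<phi>"
  proof (rule tendstoI)
    fix e :: real assume e: "e > 0"
    have "\<forall>\<^sub>F n in sequentially. (\<integral>x. spike Z s l x + \<phi> x \<partial>\<nu>) - e / 2 < (\<integral>x. spike Z s l x + \<phi> x \<partial>\<mu> n)"
    proof (rule integral_le_liminf_if_spikes[OF s \<mu> \<nu> dense conv])
      show "0 \<le> spike Z s l x + \<phi> x" if "x \<in> mspace Z" for x using dom[OF that] by auto
    qed (use e int_\<phi> int_l cont cont_l in \<open>auto intro: continuous_intros\<close>)
    moreover have "\<forall>\<^sub>F n in sequentially. (\<integral>x. spike Z s l x - \<phi> x \<partial>\<nu>) - e / 2 < (\<integral>x. spike Z s l x - \<phi> x \<partial>\<mu> n)"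
    proof (rule integral_le_liminf_if_spikes[OF s \<mu> \<nu> dense conv])
      show "0 \<le> spike Z s l x - \<phi> x" if "x \<in> mspace Z" for x using dom[OF that] by auto
    qed (use e int_\<phi> int_l cont cont_l in \<open>auto intro: continuous_intros\<close>)
    moreover have "\<forall>\<^sub>F n in sequentially. dist (integral\<^sup>L (\<mu> n) (spike Z s l)) (integral\<^sup>L \<nu> (spike Z s l)) < e / 2"
      using conv e by (intro tendstoD) auto
    ultimately show "\<forall>\<^sub>F n in sequentially. dist (integral\<^sup>L (\<mu> n) \<phi>) (integral\<^sup>L \<nu> \<phi>) < e"
    proof eventually_elim
      case (elim n)
      note elim[unfolded Bochner_Integration.integral_add[OF int_l(1) int_\<phi>(1)]
          Bochner_Integration.integral_add[OF int_l(2) int_\<phi>(2)]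
          Bochner_Integration.integral_diff[OF int_l(1) int_\<phi>(1)]
          Bochner_Integration.integral_diff[OF int_l(2) int_\<phi>(2)] dist_real_def]
      then show ?case unfolding dist_real_def by linarith
    qed
  qed
qed

section \<open>A diagonal sequence of approximations\<close>

text \<open>\<open>\<kappa> n\<close> is the largest \<open>k\<close> up to \<open>n\<close> with
  \<open>P k n\<close>. The cap \<open>n\<close> makes the maximum exist, and no monotonicity of
  \<open>P\<close> in \<open>k\<close> is involved.\<close>

lemma diagonal_index:
  fixes P :: "nat \<Rightarrow> nat \<Rightarrow> bool"
  assumes "\<And>k. eventually (P k) sequentially"
  obtains \<kappa> where "filterlim \<kappa> at_top sequentially" "eventually (\<lambda>n. P (\<kappa> n) n) sequentially"
proof -
  define \<kappa> where "\<kappa> n = Max (insert 0 {k \<in> {..n}. P k n})" for n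
  have *: "k \<le> \<kappa> n \<and> P (\<kappa> n) n" if "P k n" "k \<le> n" for k n
  proof
    show "k \<le> \<kappa> n" unfolding \<kappa>_def using that by (intro Max_ge) auto
    have "\<kappa> n \<in> insert 0 {k \<in> {..n}. P k n}" unfolding \<kappa>_def by (intro Max_in) auto
    \<comment> \<open>If the maximum is the inserted default 0, then
      \<open>k \<le> \<kappa> n\<close> forces \<open>k = 0\<close>, and \<open>P 0 n\<close> holds
      by assumption.\<close>
    then show "P (\<kappa> n) n" using \<open>k \<le> \<kappa> n\<close> that by auto
  qed
  have ev: "eventually (\<lambda>n. k \<le> \<kappa> n \<and> P (\<kappa> n) n) sequentially" for k
    using assms[of k] eventually_ge_at_top[of k] by eventually_elim (rule *)
  show thesis
  proof
    show "filterlim \<kappa> at_top sequentially"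
      unfolding filterlim_at_top
      by (intro allI eventually_mono[OF ev]) blast
    show "eventually (\<lambda>n. P (\<kappa> n) n) sequentially" using eventually_mono[OF ev[of 0]] by auto
  qed
qed

lemma AE_lborel_ex_Ioo:
  assumes "AE x in lborel. P x" "a < (b :: real)"
  shows "\<exists>x\<in>{a<..<b}. P x"
proof (rule ccontr)
  assume none: "\<not> ?thesis"
  from assms(1) have "AE x in lborel. x \<notin> {a<..<b}"
    by eventually_elim (use none in blast)
  then have "{a<..<b} \<in> null_sets lborel" by (rule AE_iff_null_sets[THEN iffD2, rotated]) simp
  then have "emeasure lborel {a<..<b} = 0" by (rule null_setsD1)
  then show False using assms(2) emeasure_lborel_Ioo[of a b] by simp
qed

section \<open>Basic facts on p.m.m. spaces and their push-forwards\<close>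

lemma pmm_space_emeasure_bounded:
  assumes "pmm_space X" "B \<in> sets (pmm_measure X)" "mbounded_of (pmm_metric X) B"
  shows "emeasure (pmm_measure X) B < \<infinity>"
proof -
  have "\<forall>B \<in> sets (pmm_measure X). mbounded_of (pmm_metric X) B \<longrightarrow> emeasure (pmm_measure X) B < \<infinity>"
    using assms(1) unfolding pmm_space_def by (elim conjE)
  from bspec[OF this assms(2)] show ?thesis using assms(3) by (rule mp)
qed

lemma sets_pmm_measure: "pmm_space X \<Longrightarrow> sets (pmm_measure X) = sets (borel_metric (pmm_metric X))"
  by (simp add: pmm_space_def)

lemma space_pmm_measure: "pmm_space X \<Longrightarrow> space (pmm_measure X) = mspace (pmm_metric X)"
  by (rule space_eq_mspace[OF sets_pmm_measure])

lemma pmm_point_in: "pmm_space X \<Longrightarrow> pmm_point X \<in> mspace (pmm_metric X)"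
  by (simp add: pmm_space_def measure_supp_def)

lemma mball_of_sets_pmm: "pmm_space X \<Longrightarrow> mball_of (pmm_metric X) a r \<in> sets (pmm_measure X)"
  by (simp add: sets_pmm_measure mball_of_sets_borel_metric)

lemma emeasure_mball_of_finite:
  assumes "pmm_space X"
  shows "emeasure (pmm_measure X) (mball_of (pmm_metric X) a r) < \<infinity>"
  by (rule pmm_space_emeasure_bounded[OF assms mball_of_sets_pmm[OF assms]])
    (simp add: mball_of_def Metric_space.mbounded_mball[OF Metric_space_mspace_mdist])

text \<open>The centre \<open>a\<close> may lie outside the image of \<open>\<iota>\<close>, so the
  preimage need not be a ball; its diameter is at most \<open>2 * r\<close>, however, which makes it
  bounded.\<close>

lemma emeasure_distr_mball_of_finite:
  assumes X: "pmm_space X" and \<iota>: "isometric_embedding (pmm_metric X) Z \<iota>"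
  shows "emeasure (distr (pmm_measure X) (borel_metric Z) \<iota>) (mball_of Z a r) < \<infinity>"
proof -
  interpret Metric_space "mspace (pmm_metric X)" "mdist (pmm_metric X)" by (rule Metric_space_mspace_mdist)
  note meas = isometric_embedding_measurable[OF \<iota> sets_pmm_measure[OF X]]
  have "mbounded (\<iota> -` mball_of Z a r \<inter> space (pmm_measure X))"
    unfolding mbounded_alt
  proof (intro conjI exI[of _ "2 * r"] ballI)
    fix x y assume "x \<in> \<iota> -` mball_of Z a r \<inter> space (pmm_measure X)"
      "y \<in> \<iota> -` mball_of Z a r \<inter> space (pmm_measure X)"
    then show "mdist (pmm_metric X) x y \<le> 2 * r"
      using \<iota> mdist_triangle[of "\<iota> x" Z a "\<iota> y"]
      by (auto simp: isometric_embedding_def space_pmm_measure[OF X] mdist_commute)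
  qed (use space_pmm_measure[OF X] in auto)
  then show ?thesis
    by (subst emeasure_distr[OF meas mball_of_sets_borel_metric])
      (rule pmm_space_emeasure_bounded[OF X measurable_sets[OF meas mball_of_sets_borel_metric]])
qed

lemma approximates_measurable:
  assumes "approximates R \<epsilon> X Y f" "pmm_space X"
  shows "f \<in> measurable (restrict_space (pmm_measure X) (pmm_ball X R)) (borel_metric (pmm_metric Y))"
  using assms(1) unfolding approximates_def
  by (subst measurable_cong_sets[OF sets_restrict_space_cong[OF sets_pmm_measure[OF assms(2)]] refl]) simp

lemma integral_spike_density_ball:
  assumes Y: "pmm_space Y" and s: "\<And>i. s i \<in> mspace (pmm_metric Y)"
  shows "integral\<^sup>L (density (pmm_measure Y) (indicator (pmm_ball Y R))) (spike (pmm_metric Y) s l)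
    = (\<integral>y. indicator (pmm_ball Y R) y * spike (pmm_metric Y) s l y \<partial>pmm_measure Y)"
proof -
  have "spike (pmm_metric Y) s l \<in> borel_measurable (pmm_measure Y)"
    by (rule continuous_map_borel_measurable[OF spike_continuous sets_pmm_measure[OF Y]]) (rule s)
  then have "integral\<^sup>L (density (pmm_measure Y) (\<lambda>y. ennreal (indicator (pmm_ball Y R) y))) (spike (pmm_metric Y) s l)
    = (\<integral>y. indicator (pmm_ball Y R) y *\<^sub>R spike (pmm_metric Y) s l y \<partial>pmm_measure Y)"
    using mball_of_sets_pmm[OF Y] by (intro integral_density) auto
  then show ?thesis by (simp add: ennreal_indicator)
qed

text \<open>The radius tends to infinity so that the restriction to balls disappears in the limit:
  every spike has bounded support. The bounds hold for every \<open>n\<close>, not just eventually,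
  because the gluing involves all indices.\<close>

lemma pmGH_diagonal:
  fixes X :: "nat \<Rightarrow> 'a pmm" and Y :: "'b pmm"
  assumes X: "\<And>n. pmm_space (X n)" and Y: "pmm_space Y" and conv: "pmGH_converges X Y"
    and s: "\<And>i. s i \<in> mspace (pmm_metric Y)" "s 0 = pmm_point Y"
  obtains r e :: "nat \<Rightarrow> real" and F :: "nat \<Rightarrow> 'a \<Rightarrow> 'b"
  where "\<And>n. r n > 0" "filterlim r at_top sequentially" "\<And>n. e n > 0" "e \<longlonglongrightarrow> 0"
    "\<And>n. F n \<in> measurable (restrict_space (pmm_measure (X n)) (pmm_ball (X n) (r n))) (borel_metric (pmm_metric Y))"
    "\<And>n. F n (pmm_point (X n)) = pmm_point Y"
    "\<And>n x y. x \<in> pmm_ball (X n) (r n) \<Longrightarrow> y \<in> pmm_ball (X n) (r n) \<Longrightarrow>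
      \<bar>mdist (pmm_metric (X n)) x y - mdist (pmm_metric Y) (F n x) (F n y)\<bar> \<le> e n"
    "\<And>l. (\<lambda>n. \<integral>x. spike (pmm_metric Y) s l (F n x) \<partial>restrict_space (pmm_measure (X n)) (pmm_ball (X n) (r n)))
      \<longlonglongrightarrow> integral\<^sup>L (pmm_measure Y) (spike (pmm_metric Y) s l)"
proof -
  obtain N :: "real \<Rightarrow> real \<Rightarrow> nat" and f :: "real \<Rightarrow> real \<Rightarrow> nat \<Rightarrow> 'a \<Rightarrow> 'b" where
    approx: "\<And>\<epsilon> R n. \<epsilon> > 0 \<Longrightarrow> R > 0 \<Longrightarrow> n \<ge> N R \<epsilon> \<Longrightarrow> approximates R \<epsilon> (X n) Y (f R \<epsilon> n)"
    and weak: "\<And>\<epsilon>. \<epsilon> > 0 \<Longrightarrow> AE R in lborel. R > 0 \<longrightarrow> weakly_converges (pmm_metric Y)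
             (\<lambda>n. distr (restrict_space (pmm_measure (X n)) (pmm_ball (X n) R))
                    (borel_metric (pmm_metric Y)) (f R \<epsilon> n))
             (density (pmm_measure Y) (indicator (pmm_ball Y R)))"
    using conv unfolding pmGH_converges_def by blast
  define \<epsilon> where "\<epsilon> k = inverse (real (Suc k))" for k
  have \<epsilon>_pos: "\<epsilon> k > 0" for k by (simp add: \<epsilon>_def)
  define W where "W k R \<longleftrightarrow> weakly_converges (pmm_metric Y)
             (\<lambda>n. distr (restrict_space (pmm_measure (X n)) (pmm_ball (X n) R))
                    (borel_metric (pmm_metric Y)) (f R (\<epsilon> k) n))
             (density (pmm_measure Y) (indicator (pmm_ball Y R)))" for k R
  \<comment> \<open>The null set of bad radii depends on \<epsilon>, so a good radius is picked
    separately for each \<open>k\<close>; an interval of positive length contains one.\<close>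
  have "\<exists>R>real k + 1. W k R" for k
    using AE_lborel_ex_Ioo[OF weak[OF \<epsilon>_pos[of k]], of "real k + 1" "real k + 2"] by (auto simp: W_def)
  then obtain R where R: "\<And>k. real k + 1 < R k" and weak_R: "\<And>k. W k (R k)"
    by metis
  have R_pos: "R k > 0" for k using R[of k] by linarith
  define I where "I l k n = (\<integral>x. spike (pmm_metric Y) s l (f (R k) (\<epsilon> k) n x)
      \<partial>restrict_space (pmm_measure (X n)) (pmm_ball (X n) (R k)))" for l k n
  define J where "J l k = (\<integral>y. indicator (pmm_ball Y (R k)) y * spike (pmm_metric Y) s l y \<partial>pmm_measure Y)" for l k
  \<comment> \<open>Only the spikes with code at most \<open>k\<close> are tested, so that
    \<open>P k\<close> holds for almost all \<open>n\<close>. Each spike is tested at all large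
    scales.\<close>
  define P where "P k n \<longleftrightarrow> approximates (R k) (\<epsilon> k) (X n) Y (f (R k) (\<epsilon> k) n)
    \<and> (\<forall>i\<in>{..k}. dist (I (from_nat i) k n) (J (from_nat i) k) < \<epsilon> k)" for k n
  have meas_spike: "spike (pmm_metric Y) s l \<in> borel_measurable (borel_metric (pmm_metric Y))" for l
    by (rule continuous_map_borel_measurable[OF spike_continuous refl]) (rule s)
  have ev_approx: "\<forall>\<^sub>F n in sequentially. approximates (R k) (\<epsilon> k) (X n) Y (f (R k) (\<epsilon> k) n)" for k
    unfolding eventually_sequentially using approx[OF \<epsilon>_pos R_pos] by blast
  have I_tendsto: "I l k \<longlonglongrightarrow> J l k" for l k
  proof -
    have "(\<lambda>n. integral\<^sup>L (distr (restrict_space (pmm_measure (X n)) (pmm_ball (X n) (R k)))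
                    (borel_metric (pmm_metric Y)) (f (R k) (\<epsilon> k) n)) (spike (pmm_metric Y) s l)) \<longlonglongrightarrow> J l k"
      using weak_R[of k] bounded_support_test_spike[of s "pmm_metric Y" l, OF s(1)]
      unfolding weakly_converges_def J_def W_def integral_spike_density_ball[OF Y s(1), symmetric] by blast
    moreover have "\<forall>\<^sub>F n in sequentially. integral\<^sup>L (distr (restrict_space (pmm_measure (X n)) (pmm_ball (X n) (R k)))
                    (borel_metric (pmm_metric Y)) (f (R k) (\<epsilon> k) n)) (spike (pmm_metric Y) s l) = I l k n"
      using ev_approx[of k]
      by eventually_elim
        (unfold I_def, rule integral_distr[OF approximates_measurable[OF _ X] meas_spike])
    ultimately show ?thesis by (rule Lim_transform_eventually)
  qed
  have "eventually (P k) sequentially" for k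
    unfolding P_def by (intro eventually_conj ev_approx eventually_ball_finite ballI tendstoD I_tendsto \<epsilon>_pos) auto
  then obtain \<kappa> where \<kappa>: "filterlim \<kappa> at_top sequentially" and ev: "eventually (\<lambda>n. P (\<kappa> n) n) sequentially"
    using diagonal_index[of P] by blast
  \<comment> \<open>For the finitely many bad \<open>n\<close>, a constant map distorts the unit ball by at most \<open>2\<close>.\<close>
  define r where "r n = (if P (\<kappa> n) n then R (\<kappa> n) else 1)" for n
  define e where "e n = (if P (\<kappa> n) n then \<epsilon> (\<kappa> n) else 2)" for n
  define F where "F n = (if P (\<kappa> n) n then f (R (\<kappa> n)) (\<epsilon> (\<kappa> n)) n else (\<lambda>_. pmm_point Y))" for n
  have \<epsilon>_tendsto: "(\<lambda>n. \<epsilon> (\<kappa> n)) \<longlonglongrightarrow> 0"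
    using filterlim_compose[OF LIMSEQ_inverse_real_of_nat \<kappa>] by (simp add: \<epsilon>_def)
  show thesis
  proof
    show "r n > 0" "e n > 0" for n using R_pos \<epsilon>_pos by (auto simp: r_def e_def)
    have R_lim: "filterlim (\<lambda>n. R (\<kappa> n)) at_top sequentially"
    proof (rule filterlim_at_top_mono)
      show "filterlim (\<lambda>n. real (\<kappa> n)) at_top sequentially"
        using filterlim_compose[OF filterlim_real_sequentially \<kappa>] .
      show "\<forall>\<^sub>F n in sequentially. real (\<kappa> n) \<le> R (\<kappa> n)"
        using R by (intro always_eventually allI) (smt (verit))
    qed
    show "filterlim r at_top sequentially"
      by (rule filterlim_mono_eventually[OF R_lim order_refl order_refl])
        (use ev in eventually_elim, simp add: r_def)
    show "e \<longlonglongrightarrow> 0"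
      by (rule Lim_transform_eventually[OF \<epsilon>_tendsto]) (use ev in eventually_elim, simp add: e_def)
    show "F n \<in> measurable (restrict_space (pmm_measure (X n)) (pmm_ball (X n) (r n))) (borel_metric (pmm_metric Y))" for n
      using approximates_measurable[OF _ X[of n]] pmm_point_in[OF Y]
      by (auto simp: F_def r_def P_def)
    show "F n (pmm_point (X n)) = pmm_point Y" for n
      by (auto simp: F_def P_def approximates_def)
    show "\<bar>mdist (pmm_metric (X n)) x y - mdist (pmm_metric Y) (F n x) (F n y)\<bar> \<le> e n"
      if xy: "x \<in> pmm_ball (X n) (r n)" "y \<in> pmm_ball (X n) (r n)" for n x y
    proof (cases "P (\<kappa> n) n")
      case True
      then show ?thesis using xy by (auto simp: F_def r_def e_def P_def approximates_def)
    next
      case False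
      then show ?thesis
        using xy mdist_triangle[of x "pmm_metric (X n)" "pmm_point (X n)" y] pmm_point_in[OF Y]
        by (auto simp: F_def r_def e_def mdist_commute)
    qed
    fix l
    obtain \<rho> where \<rho>: "\<And>y. y \<in> mspace (pmm_metric Y) \<Longrightarrow> spike (pmm_metric Y) s l y \<noteq> 0
        \<Longrightarrow> mdist (pmm_metric Y) (s 0) y < \<rho>"
      using spike_support[of s "pmm_metric Y" l, OF s(1)] by auto
    \<comment> \<open>Since \<open>s 0\<close> is the base point, the ball of radius
      \<open>R k\<close> contains the support of the spike once
      \<open>\<rho> \<le> R k\<close>.\<close>
    have J_eq: "J l k = integral\<^sup>L (pmm_measure Y) (spike (pmm_metric Y) s l)" if "\<rho> \<le> R k" for k
      unfolding J_def
    proof (rule Bochner_Integration.integral_cong)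
      fix y assume "y \<in> space (pmm_measure Y)"
      then show "indicator (pmm_ball Y (R k)) y * spike (pmm_metric Y) s l y = spike (pmm_metric Y) s l y"
        using \<rho>[of y] that s(2) pmm_point_in[OF Y] space_pmm_measure[OF Y]
        by (cases "spike (pmm_metric Y) s l y = 0") auto
    qed simp
    have "(\<lambda>n. I l (\<kappa> n) n - J l (\<kappa> n)) \<longlonglongrightarrow> 0"
    proof (rule Lim_null_comparison[OF _ \<epsilon>_tendsto])
      have "\<forall>\<^sub>F n in sequentially. to_nat l \<le> \<kappa> n"
        using \<kappa> unfolding filterlim_at_top by blast
      with ev show "\<forall>\<^sub>F n in sequentially. norm (I l (\<kappa> n) n - J l (\<kappa> n)) \<le> \<epsilon> (\<kappa> n)"
      proof eventually_elim
        case (elim n)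
        then have "dist (I (from_nat (to_nat l)) (\<kappa> n) n) (J (from_nat (to_nat l)) (\<kappa> n)) < \<epsilon> (\<kappa> n)"
          unfolding P_def by blast
        then show ?case by (simp add: dist_norm)
      qed
    qed
    moreover have "\<forall>\<^sub>F n in sequentially. \<rho> \<le> R (\<kappa> n)"
      using R_lim unfolding filterlim_at_top by blast
    with ev have "\<forall>\<^sub>F n in sequentially. I l (\<kappa> n) n - J l (\<kappa> n) =
      (\<integral>x. spike (pmm_metric Y) s l (F n x) \<partial>restrict_space (pmm_measure (X n)) (pmm_ball (X n) (r n)))
      - integral\<^sup>L (pmm_measure Y) (spike (pmm_metric Y) s l)"
      by eventually_elim (simp add: J_eq, simp add: I_def F_def r_def)
    ultimately have "(\<lambda>n. (\<integral>x. spike (pmm_metric Y) s l (F n x) \<partial>restrict_space (pmm_measure (X n)) (pmm_ball (X n) (r n)))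
      - integral\<^sup>L (pmm_measure Y) (spike (pmm_metric Y) s l)) \<longlonglongrightarrow> 0"
      by (rule Lim_transform_eventually)
    then show "(\<lambda>n. \<integral>x. spike (pmm_metric Y) s l (F n x) \<partial>restrict_space (pmm_measure (X n)) (pmm_ball (X n) (r n)))
      \<longlonglongrightarrow> integral\<^sup>L (pmm_measure Y) (spike (pmm_metric Y) s l)"
      by (simp add: LIM_zero_iff)
  qed
qed

section \<open>Comparison in the glued space\<close>

text \<open>Two discrepancies are removed: \<open>\<iota> n x\<close> replaces
  \<open>\<iota>inf (F n x)\<close>, which costs a Lipschitz constant times \<open>e n\<close>, and
  the integral runs over all of \<open>X n\<close> instead of a ball, which eventually changes
  nothing on the support of the spike.\<close>

lemma spike_integrals_transfer:
  fixes X :: "nat \<Rightarrow> 'a pmm" and Y :: "'b pmm" and Z :: "'c metric"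
  assumes X: "\<And>n. pmm_space (X n)" and Y: "pmm_space Y"
    and s: "\<And>i. s i \<in> mspace (pmm_metric Y)" "s 0 = pmm_point Y"
    and r: "\<And>n. r n > 0" "filterlim r at_top sequentially" and e: "e \<longlonglongrightarrow> 0"
    and F: "\<And>n. F n \<in> measurable (restrict_space (pmm_measure (X n)) (pmm_ball (X n) (r n))) (borel_metric (pmm_metric Y))"
    and F_point: "\<And>n. F n (pmm_point (X n)) = pmm_point Y"
    and \<iota>: "\<And>n. isometric_embedding (pmm_metric (X n)) Z (\<iota> n)"
    and \<iota>inf: "isometric_embedding (pmm_metric Y) Z \<iota>inf"
    and close: "\<And>n x. x \<in> pmm_ball (X n) (r n) \<Longrightarrow> mdist Z (\<iota> n x) (\<iota>inf (F n x)) \<le> e n"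
    and conv: "\<And>l. (\<lambda>n. \<integral>x. spike (pmm_metric Y) s l (F n x) \<partial>restrict_space (pmm_measure (X n)) (pmm_ball (X n) (r n)))
      \<longlonglongrightarrow> integral\<^sup>L (pmm_measure Y) (spike (pmm_metric Y) s l)"
  shows "(\<lambda>n. \<integral>x. spike Z (\<iota>inf \<circ> s) l (\<iota> n x) \<partial>pmm_measure (X n))
    \<longlonglongrightarrow> integral\<^sup>L (pmm_measure Y) (spike (pmm_metric Y) s l)"
proof -
  define c where "c = \<iota>inf (pmm_point Y)"
  define B where "B n = pmm_ball (X n) (r n)" for n
  define h where "h n x = spike Z (\<iota>inf \<circ> s) l (\<iota> n x)" for n x
  \<comment> \<open>\<open>F n\<close> is controlled only on \<open>B n\<close>; the cut-off makes
    \<open>g l n\<close> measurable on the whole space.\<close>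
  define g where "g l n x = indicator (B n) x * spike (pmm_metric Y) s l (F n x)" for l n x
  have s': "(\<iota>inf \<circ> s) i \<in> mspace Z" for i using \<iota>inf s(1) by (auto simp: isometric_embedding_def)
  have c: "c \<in> mspace Z" "(\<iota>inf \<circ> s) 0 = c" using s'[of 0] s(2) by (auto simp: c_def)
  have \<iota>_mem: "\<iota> n x \<in> mspace Z" if "x \<in> mspace (pmm_metric (X n))" for n x
    using \<iota>[of n] that by (auto simp: isometric_embedding_def)
  have B_mem: "x \<in> mspace (pmm_metric (X n))" if "x \<in> B n" for n x using that by (simp add: B_def)
  have space_restrict: "space (restrict_space (pmm_measure (X n)) (B n)) = B n" for n
    unfolding space_restrict_space space_pmm_measure[OF X] using B_mem by blast
  have F_mem: "F n x \<in> mspace (pmm_metric Y)" if "x \<in> B n" for n x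
    using measurable_space[OF F[of n]] that space_restrict[of n] by (simp add: B_def)
  have \<iota>F_mem: "\<iota>inf (F n x) \<in> mspace Z" if "x \<in> B n" for n x
    using F_mem[OF that] \<iota>inf by (auto simp: isometric_embedding_def)
  have dist_\<iota>: "mdist Z (\<iota> n x) (\<iota> n (pmm_point (X n))) = mdist (pmm_metric (X n)) (pmm_point (X n)) x"
    if "x \<in> mspace (pmm_metric (X n))" for n x
    using \<iota>[of n] that pmm_point_in[OF X[of n]] by (simp add: isometric_embedding_def mdist_commute)
  have center: "mdist Z (\<iota> n (pmm_point (X n))) c \<le> e n" for n
    using close[of "pmm_point (X n)" n] pmm_point_in[OF X[of n]] r(1)[of n]
    by (simp add: F_point c_def)
  have dist_c: "\<bar>mdist Z c (\<iota> n x) - mdist (pmm_metric (X n)) (pmm_point (X n)) x\<bar> \<le> e n"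
    if "x \<in> mspace (pmm_metric (X n))" for n x
    using mdist_triangle[OF \<iota>_mem[OF that] \<iota>_mem[OF pmm_point_in[OF X[of n]]] c(1)]
      mdist_triangle[OF \<iota>_mem[OF that] c(1) \<iota>_mem[OF pmm_point_in[OF X[of n]]]] center[of n] dist_\<iota>[OF that]
    by (simp add: mdist_commute abs_le_iff)
  \<comment> \<open>One \<open>e n\<close> is the offset of the base points, the other the gap
    between \<open>\<iota> n x\<close> and \<open>\<iota>inf (F n x)\<close>.\<close>
  have dist_c_F: "\<bar>mdist Z c (\<iota>inf (F n x)) - mdist (pmm_metric (X n)) (pmm_point (X n)) x\<bar> \<le> 2 * e n"
    if x: "x \<in> B n" for n x
    using mdist_triangle[OF c(1) \<iota>_mem[OF B_mem[OF x]] \<iota>F_mem[OF x]]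
      mdist_triangle[OF c(1) \<iota>F_mem[OF x] \<iota>_mem[OF B_mem[OF x]]]
      close[of x n] dist_c[OF B_mem[OF x]] x
    by (simp add: mdist_commute abs_le_iff B_def)
  have g_eq: "g l n x = spike Z (\<iota>inf \<circ> s) l (\<iota>inf (F n x))" if "x \<in> B n" for l n x
    using spike_isometric[of "pmm_metric Y" Z \<iota>inf s "F n x" l, OF \<iota>inf s(1) F_mem[OF that]] that
    by (simp add: g_def)
  have g_outside: "g l n x = 0" if "x \<notin> B n" for l n x using that by (simp add: g_def)
  have g_nonneg: "0 \<le> g l n x" for l n x by (simp add: g_def spike_nonneg)
  have B_sets: "B n \<in> sets (pmm_measure (X n))" "B n \<inter> space (pmm_measure (X n)) \<in> sets (pmm_measure (X n))" for n
    using mball_of_sets_pmm[OF X] by (auto simp: B_def)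
  have ball_sets: "pmm_ball (X n) t \<in> sets (pmm_measure (X n))" for n t
    using mball_of_sets_pmm[OF X] .
  have ball_fin: "emeasure (pmm_measure (X n)) (pmm_ball (X n) t) < \<infinity>" for n t
    using emeasure_mball_of_finite[OF X] .
  have int_g: "integrable (pmm_measure (X n)) (g l n)" for l n
  proof -
    obtain A where A: "\<And>x. spike (pmm_metric Y) s l x \<le> A" "A \<ge> 0" using spike_bounded by blast
    have "spike (pmm_metric Y) s l \<in> borel_measurable (borel_metric (pmm_metric Y))"
      by (rule continuous_map_borel_measurable[OF spike_continuous refl]) (rule s(1))
    then have "(\<lambda>x. spike (pmm_metric Y) s l (F n x)) \<in> borel_measurable (restrict_space (pmm_measure (X n)) (B n))"
      using measurable_compose[OF F[of n]] by (simp add: B_def)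
    then have "g l n \<in> borel_measurable (pmm_measure (X n))"
      unfolding borel_measurable_restrict_space_iff[OF B_sets(2)] g_def by simp
    moreover have "emeasure (pmm_measure (X n)) (B n) < \<infinity>" unfolding B_def by (rule ball_fin)
    ultimately show ?thesis
      by (rule integrableI_bounded_set[OF B_sets(1), where B = A])
        (rule AE_I2, simp add: g_def A spike_nonneg)+
  qed
  have g_tendsto: "(\<lambda>n. integral\<^sup>L (pmm_measure (X n)) (g l n))
      \<longlonglongrightarrow> integral\<^sup>L (pmm_measure Y) (spike (pmm_metric Y) s l)" for l
    using conv[of l] unfolding B_def[symmetric] integral_restrict_space[OF B_sets(2)] g_def by simp
  have int_h: "integrable (pmm_measure (X n)) (h n)" for n
  proof -
    note meas = isometric_embedding_measurable[OF \<iota>[of n] sets_pmm_measure[OF X]]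
    have "integrable (distr (pmm_measure (X n)) (borel_metric Z) (\<iota> n)) (spike Z (\<iota>inf \<circ> s) l)"
      by (rule integrable_spike[OF s' _ emeasure_distr_mball_of_finite[OF X \<iota>]]) simp
    then show ?thesis using integrable_distr[OF meas] unfolding h_def by blast
  qed
  obtain L where L: "L \<ge> 0" and L_le: "\<And>x y. x \<in> mspace Z \<Longrightarrow> y \<in> mspace Z \<Longrightarrow>
      \<bar>spike Z (\<iota>inf \<circ> s) l x - spike Z (\<iota>inf \<circ> s) l y\<bar> \<le> L * mdist Z x y"
    using spike_Lipschitz[of "\<iota>inf \<circ> s" Z l, OF s'] by blast
  obtain \<rho> where \<rho>: "\<And>x. x \<in> mspace Z \<Longrightarrow> spike Z (\<iota>inf \<circ> s) l x \<noteq> 0 \<Longrightarrow> mdist Z c x < \<rho>"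
    using spike_support[of "\<iota>inf \<circ> s" Z l, OF s'] unfolding c(2) by blast
  \<comment> \<open>Once \<open>e n < 1\<close>, \<open>h n\<close> vanishes beyond distance
    \<open>\<rho> + 1\<close> from the base point and \<open>g l n\<close> beyond
    \<open>\<rho> + 2\<close>, so \<open>K n\<close> contains both supports.\<close>
  define K where "K n = pmm_ball (X n) (\<rho> + 2)" for n
  have ev: "\<forall>\<^sub>F n in sequentially. e n < 1 \<and> \<rho> + 2 < r n"
    using order_tendstoD(2)[OF e, of 1] r(2) by (auto simp: filterlim_at_top_dense eventually_conj_iff)
  \<comment> \<open>Points of \<open>K n\<close> are sent by \<open>F n\<close> to within
    \<open>\<rho> + 4\<close> of the base point, so the cone of height \<open>k\<close> and slope 1
    exceeds 1 there.\<close>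
  obtain k :: nat where k: "\<rho> + 5 < real k" using reals_Archimedean2 by blast
  define M where "M = integral\<^sup>L (pmm_measure Y) (spike (pmm_metric Y) s [(of_nat k, 0, 0)]) + 1"
  \<comment> \<open>A mass bound uniform in \<open>n\<close> is not part of the hypotheses on the
    single spaces; it comes from the convergence for one cone lying above the indicator of
    \<open>K n\<close>.\<close>
  have mass: "\<forall>\<^sub>F n in sequentially. measure (pmm_measure (X n)) (K n) \<le> M"
  proof -
    have "\<forall>\<^sub>F n in sequentially. integral\<^sup>L (pmm_measure (X n)) (g [(of_nat k, 0, 0)] n) < M"
      using g_tendsto by (rule order_tendstoD) (simp add: M_def)
    with ev show ?thesis
    proof eventually_elim
      case (elim n)
      have "measure (pmm_measure (X n)) (K n) = (\<integral>x. indicator (K n) x \<partial>pmm_measure (X n))"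
        using ball_sets[of n] sets.sets_into_space[OF ball_sets[of n]] by (simp add: K_def Int_absorb2)
      also have "\<dots> \<le> integral\<^sup>L (pmm_measure (X n)) (g [(of_nat k, 0, 0)] n)"
      proof (rule integral_mono)
        show "integrable (pmm_measure (X n)) (indicator (K n) :: 'a \<Rightarrow> real)"
          using ball_sets ball_fin unfolding K_def by (intro integrable_real_indicator) auto
        show "indicator (K n) x \<le> g [(of_nat k, 0, 0)] n x" for x
        proof (cases "x \<in> K n")
          case True
          then have xB: "x \<in> B n" using elim by (simp add: K_def B_def)
          have "mdist Z c (\<iota>inf (F n x)) \<le> \<rho> + 4"
            using dist_c_F[OF xB] True elim by (simp add: K_def abs_le_iff)
          then show ?thesis
            using g_eq[OF xB, of "[(of_nat k, 0, 0)]"] True k c(2) by (simp add: mdist_commute)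
        qed (simp add: g_nonneg)
      qed (rule int_g)
      finally show ?case using elim by simp
    qed
  qed
  have "\<forall>\<^sub>F n in sequentially.
    norm (integral\<^sup>L (pmm_measure (X n)) (h n) - integral\<^sup>L (pmm_measure (X n)) (g l n)) \<le> L * e n * M"
    using ev mass
  proof eventually_elim
    case (elim n)
    have e_n: "0 \<le> e n" by (rule order_trans[OF mdist_nonneg center])
    have pointwise: "\<bar>h n x - g l n x\<bar> \<le> L * e n * indicator (K n) x"
      if x: "x \<in> mspace (pmm_metric (X n))" for x
    proof (cases "x \<in> K n")
      case True
      then have xB: "x \<in> B n" using elim by (simp add: K_def B_def)
      have "\<bar>h n x - g l n x\<bar> \<le> L * mdist Z (\<iota> n x) (\<iota>inf (F n x))"
        unfolding h_def g_eq[OF xB] by (rule L_le[OF \<iota>_mem[OF x] \<iota>F_mem[OF xB]])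
      also have "\<dots> \<le> L * e n" using close[of x n] xB L by (intro mult_left_mono) (auto simp: B_def)
      finally show ?thesis using True by simp
    next
      \<comment> \<open>Outside \<open>K n\<close> the estimates on distances to \<open>c\<close>
        put both arguments of the spike outside its support, whether or not \<open>x\<close> lies in
        \<open>B n\<close>.\<close>
      case False
      then have far: "\<rho> + 2 \<le> mdist (pmm_metric (X n)) (pmm_point (X n)) x"
        using x pmm_point_in[OF X[of n]] by (simp add: K_def)
      have "h n x = 0"
        unfolding h_def using \<rho>[OF \<iota>_mem[OF x]] dist_c[OF x] far elim by (smt (verit))
      moreover have "g l n x = 0"
      proof (cases "x \<in> B n")
        case True
        then show ?thesis
          unfolding g_eq[OF True] using \<rho>[OF \<iota>F_mem[OF True]] dist_c_F[OF True] far elim by (smt (verit))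
      qed (rule g_outside)
      ultimately show ?thesis using False by simp
    qed
    have int_K: "integrable (pmm_measure (X n)) (\<lambda>x. L * e n * indicator (K n) x)"
      using ball_sets ball_fin unfolding K_def by (intro integrable_mult_right integrable_real_indicator) auto
    have "norm (integral\<^sup>L (pmm_measure (X n)) (h n) - integral\<^sup>L (pmm_measure (X n)) (g l n))
      = norm (\<integral>x. h n x - g l n x \<partial>pmm_measure (X n))"
      using int_h int_g by simp
    also have "\<dots> \<le> (\<integral>x. L * e n * indicator (K n) x \<partial>pmm_measure (X n))"
    proof (rule order_trans[OF integral_norm_bound integral_mono[OF _ int_K]])
      show "integrable (pmm_measure (X n)) (\<lambda>x. norm (h n x - g l n x))"
        by (intro integrable_norm Bochner_Integration.integrable_diff int_h int_g)
      show "norm (h n x - g l n x) \<le> L * e n * indicator (K n) x" if "x \<in> space (pmm_measure (X n))" for x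
        using pointwise[of x] that unfolding space_pmm_measure[OF X] real_norm_def by blast
    qed
    also have "\<dots> = L * e n * measure (pmm_measure (X n)) (K n)"
      using ball_sets[of n] sets.sets_into_space[OF ball_sets[of n]] by (simp add: K_def Int_absorb2)
    also have "\<dots> \<le> L * e n * M"
      using elim e_n L by (intro mult_left_mono) auto
    finally show ?case .
  qed
  moreover have "(\<lambda>n. L * e n * M) \<longlonglongrightarrow> 0"
    using tendsto_mult_left[OF e, of L] tendsto_mult_right[of "\<lambda>n. L * e n" 0 sequentially M] by simp
  ultimately have "(\<lambda>n. integral\<^sup>L (pmm_measure (X n)) (h n) - integral\<^sup>L (pmm_measure (X n)) (g l n)) \<longlonglongrightarrow> 0"
    by (rule Lim_null_comparison)
  from tendsto_add[OF this g_tendsto[of l]] show ?thesis unfolding h_def by simp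
qed

section \<open>Assembly of the realization\<close>

theorem proposition3p30:
  fixes X :: "nat \<Rightarrow> 'a pmm" and Xinf :: "'b pmm"
  assumes "\<And>n. pmm_space (X n)"
    and "pmm_space Xinf"
    and "pmGH_converges X Xinf"
  shows "pmG_converges X Xinf"
proof -
  note X = assms(1) and Y = assms(2)
  let ?Y = "pmm_metric Xinf"
  have sep: "separable_space (mtopology_of (pmm_metric (X n)))" "separable_space (mtopology_of ?Y)" for n
    using X[of n] Y by (simp_all add: pmm_space_def)
  obtain C where C: "countable C" "C \<subseteq> mspace ?Y"
    "\<And>z t. z \<in> mspace ?Y \<Longrightarrow> 0 < t \<Longrightarrow> \<exists>y\<in>C. mdist ?Y z y < t"
    using sep(2) unfolding separable_space_mtopology_of by blast
  \<comment> \<open>Index 0 is reserved for the base point, making supports and restricting balls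
    concentric. Inserting the base point makes the enumerated set visibly nonempty, as
    \<open>from_nat_into\<close> requires.\<close>
  define s where "s i = (case i of 0 \<Rightarrow> pmm_point Xinf | Suc j \<Rightarrow> from_nat_into (insert (pmm_point Xinf) C) j)" for i
  have s: "s i \<in> mspace ?Y" for i
  proof -
    have "from_nat_into (insert (pmm_point Xinf) C) j \<in> insert (pmm_point Xinf) C" for j
      by (rule from_nat_into) simp
    then show ?thesis using pmm_point_in[OF Y] C(2) unfolding s_def by (cases i) (simp, force)
  qed
  have s_0: "s 0 = pmm_point Xinf" by (simp add: s_def)
  have s_dense: "\<exists>i. mdist ?Y y (s i) < t" if y: "y \<in> mspace ?Y" and t: "t > 0" for y t
  proof -
    obtain y' where y': "y' \<in> C" "mdist ?Y y y' < t" using C(3)[OF y t] by blast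
    have "countable (insert (pmm_point Xinf) C)" using C(1) by simp
    from from_nat_into_surj[OF this] obtain j where "from_nat_into (insert (pmm_point Xinf) C) j = y'"
      using y'(1) by blast
    then have "s (Suc j) = y'" by (simp add: s_def)
    then show ?thesis using y'(2) by blast
  qed
  obtain r e :: "nat \<Rightarrow> real" and F :: "nat \<Rightarrow> 'a \<Rightarrow> 'b" where
    r: "\<And>n. r n > 0" "filterlim r at_top sequentially" and e: "\<And>n. e n > 0" "e \<longlonglongrightarrow> 0"
    and F: "\<And>n. F n \<in> measurable (restrict_space (pmm_measure (X n)) (pmm_ball (X n) (r n))) (borel_metric ?Y)"
    and F_point: "\<And>n. F n (pmm_point (X n)) = pmm_point Xinf"
    and distortion: "\<And>n x y. x \<in> pmm_ball (X n) (r n) \<Longrightarrow> y \<in> pmm_ball (X n) (r n) \<Longrightarrow>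
      \<bar>mdist (pmm_metric (X n)) x y - mdist ?Y (F n x) (F n y)\<bar> \<le> e n"
    and conv: "\<And>l. (\<lambda>n. \<integral>x. spike ?Y s l (F n x) \<partial>restrict_space (pmm_measure (X n)) (pmm_ball (X n) (r n)))
      \<longlonglongrightarrow> integral\<^sup>L (pmm_measure Xinf) (spike ?Y s l)"
    using pmGH_diagonal[of X Xinf s, OF X Y assms(3) s s_0] by blast
  have point_in_ball: "pmm_point (X n) \<in> pmm_ball (X n) (r n)" for n
    using pmm_point_in[OF X[of n]] r(1)[of n] by simp
  interpret star_gluing "\<lambda>n. pmm_metric (X n)" ?Y "\<lambda>n. pmm_ball (X n) (r n)" F e
  proof
    show "pmm_ball (X n) (r n) \<noteq> {}" for n using point_in_ball by blast
    show "pmm_ball (X n) (r n) \<subseteq> mspace (pmm_metric (X n))" for n by (rule subsetI) simp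
    show "F n x \<in> mspace ?Y" if "x \<in> pmm_ball (X n) (r n)" for n x
    proof -
      have "x \<in> space (restrict_space (pmm_measure (X n)) (pmm_ball (X n) (r n)))"
        unfolding space_restrict_space space_pmm_measure[OF X] using that by simp
      from measurable_space[OF F this] show ?thesis by simp
    qed
  qed (rule distortion e(1); assumption?)+
  obtain Z :: "(nat \<Rightarrow> real) metric" and \<iota> \<iota>inf where
    Z: "mcomplete_of Z" "separable_space (mtopology_of Z)"
    and \<iota>: "\<And>n. isometric_embedding (pmm_metric (X n)) Z (\<iota> n)"
    and \<iota>inf: "isometric_embedding ?Y Z \<iota>inf"
    and close: "\<And>n x. x \<in> pmm_ball (X n) (r n) \<Longrightarrow> mdist Z (\<iota> n x) (\<iota>inf (F n x)) \<le> e n"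
    using gluing_embeds_nat_real[OF countableI_type sep] by blast
  have \<iota>_meas: "\<iota> n \<in> measurable (pmm_measure (X n)) (borel_metric Z)" for n
    by (rule isometric_embedding_measurable[OF \<iota> sets_pmm_measure[OF X]])
  have \<iota>inf_meas: "\<iota>inf \<in> measurable (pmm_measure Xinf) (borel_metric Z)"
    by (rule isometric_embedding_measurable[OF \<iota>inf sets_pmm_measure[OF Y]])
  have \<iota>inf_mem: "\<iota>inf y \<in> mspace Z" if "y \<in> mspace ?Y" for y
    using \<iota>inf that by (auto simp: isometric_embedding_def)
  have s': "(\<iota>inf \<circ> s) i \<in> mspace Z" for i using \<iota>inf_mem[OF s] by simp
  have spike_meas: "spike Z (\<iota>inf \<circ> s) l \<in> borel_measurable (borel_metric Z)" for l
    by (rule continuous_map_borel_measurable[OF spike_continuous refl]) (rule s')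
  have "weakly_converges Z (\<lambda>n. distr (pmm_measure (X n)) (borel_metric Z) (\<iota> n))
      (distr (pmm_measure Xinf) (borel_metric Z) \<iota>inf)"
  proof (rule weakly_converges_if_spikes[where s = "\<iota>inf \<circ> s"])
    show "AE z in distr (pmm_measure Xinf) (borel_metric Z) \<iota>inf. \<forall>t>0. \<exists>i. mdist Z z ((\<iota>inf \<circ> s) i) < t"
    proof (subst AE_distr_iff[OF \<iota>inf_meas])
      \<comment> \<open>\<open>AE_distr_iff\<close> requires this set to be measurable; it is the
        closure of the set of centres, hence closed.\<close>
      have "{z \<in> space (borel_metric Z). \<forall>t>0. \<exists>i. mdist Z z ((\<iota>inf \<circ> s) i) < t}
        = mtopology_of Z closure_of range (\<iota>inf \<circ> s)"
        using s' by (auto simp: closure_of_mtopology_of)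
      also have "\<dots> = space (borel_metric Z) - (topspace (mtopology_of Z) - mtopology_of Z closure_of range (\<iota>inf \<circ> s))"
        using closure_of_subset_topspace[of "mtopology_of Z" "range (\<iota>inf \<circ> s)"] by auto
      also have "\<dots> \<in> sets (borel_metric Z)"
        by (intro sets.compl_sets openin_sets_borel_metric openin_diff openin_topspace closedin_closure_of)
      finally show "{z \<in> space (borel_metric Z). \<forall>t>0. \<exists>i. mdist Z z ((\<iota>inf \<circ> s) i) < t} \<in> sets (borel_metric Z)" .
      show "AE y in pmm_measure Xinf. \<forall>t>0. \<exists>i. mdist Z (\<iota>inf y) ((\<iota>inf \<circ> s) i) < t"
      proof (rule AE_I2, intro allI impI)
        fix y t assume "y \<in> space (pmm_measure Xinf)" and t: "(0::real) < t"
        then have y: "y \<in> mspace ?Y" using space_pmm_measure[OF Y] by metis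
        obtain i where "mdist ?Y y (s i) < t" using s_dense[OF y t] by blast
        then have "mdist Z (\<iota>inf y) ((\<iota>inf \<circ> s) i) < t"
          using \<iota>inf y s unfolding isometric_embedding_def by simp
        then show "\<exists>i. mdist Z (\<iota>inf y) ((\<iota>inf \<circ> s) i) < t" by blast
      qed
    qed
    show "(\<lambda>n. integral\<^sup>L (distr (pmm_measure (X n)) (borel_metric Z) (\<iota> n)) (spike Z (\<iota>inf \<circ> s) l))
      \<longlonglongrightarrow> integral\<^sup>L (distr (pmm_measure Xinf) (borel_metric Z) \<iota>inf) (spike Z (\<iota>inf \<circ> s) l)" for l
    proof -
      have "integral\<^sup>L (distr (pmm_measure Xinf) (borel_metric Z) \<iota>inf) (spike Z (\<iota>inf \<circ> s) l)
        = integral\<^sup>L (pmm_measure Xinf) (spike ?Y s l)"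
        unfolding integral_distr[OF \<iota>inf_meas spike_meas]
        by (intro Bochner_Integration.integral_cong refl spike_isometric[OF \<iota>inf s])
          (simp only: space_pmm_measure[OF Y])
      moreover have "(\<lambda>n. \<integral>x. spike Z (\<iota>inf \<circ> s) l (\<iota> n x) \<partial>pmm_measure (X n))
        \<longlonglongrightarrow> integral\<^sup>L (pmm_measure Xinf) (spike ?Y s l)"
        by (rule spike_integrals_transfer[OF X Y s s_0 r e(2) F F_point \<iota> \<iota>inf close conv])
      ultimately show ?thesis unfolding integral_distr[OF \<iota>_meas spike_meas] by simp
    qed
  qed (simp_all only: sets_distr s' emeasure_distr_mball_of_finite[OF X \<iota>] emeasure_distr_mball_of_finite[OF Y \<iota>inf])
  moreover have "limitin (mtopology_of Z) (\<lambda>n. \<iota> n (pmm_point (X n))) (\<iota>inf (pmm_point Xinf)) sequentially"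
    unfolding mtopology_of_def Metric_space.limitin_metric_dist_null[OF Metric_space_mspace_mdist]
  proof (intro conjI always_eventually allI)
    show "\<iota>inf (pmm_point Xinf) \<in> mspace Z" by (rule \<iota>inf_mem[OF pmm_point_in[OF Y]])
    show "\<iota> n (pmm_point (X n)) \<in> mspace Z" for n
      using \<iota>[of n] pmm_point_in[OF X[of n]] by (auto simp: isometric_embedding_def)
    \<comment> \<open>\<open>F n\<close> sends base point to base point, so the base points are
      themselves joined by a bridge of length at most \<open>e n\<close>.\<close>
    show "(\<lambda>n. mdist Z (\<iota> n (pmm_point (X n))) (\<iota>inf (pmm_point Xinf))) \<longlonglongrightarrow> 0"
      using close[OF point_in_ball] unfolding F_point
      by (intro Lim_null_comparison[OF always_eventually e(2)]) simp
  qed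
  ultimately have "pmG_realization X Xinf Z \<iota> \<iota>inf"
    unfolding pmG_realization_def using Z \<iota> \<iota>inf by (intro conjI allI)
  then show ?thesis unfolding pmG_converges_def by (intro exI)
qed

end
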